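(* Given any real constants $C, \varepsilon > 0$, there exist $\gamma, n_0 > 0$ for which the following holds. Every graph $G = (V,E)$ with $n \ge n_0$ vertices, $m \le Cn$ edges, maximum degree at most $\gamma n$, and exactly $\tau$ tight components, admits a bisection $V = V_1 \cup V_2$ where each $V_i$ ($i=1,2$) induces at most $$\frac{m}{4} - \frac{n-\tau}{8} + \varepsilon n$$ edges.
   Context: Graphs are finite and simple. A bisection of a graph is a bipartition $V = V_1 \cup V_2$ of its vertex set into disjoint parts with $\big||V_1|-|V_2|\big| \le 1$. A connected component $T$ of a graph is called a tight component if: (i) for every vertex $v \in T$, the subgraph induced by $T \setminus \{v\}$ contains a perfect matching; and (ii) for every vertex $v \in T$ and every perfect matching of $T \setminus \{v\}$, no edge of the matching has exactly one endpoint adjacent to $v$. (In particular, an isolated vertex is a tight component.) *)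

theory Defs imports Complex_Main begin

text \<open>A graph is a pair of a vertex set \<open>V\<close> and a set \<open>E\<close> of two-element subsets of \<open>V\<close>.\<close>

definition simple_graph :: "'a set \<Rightarrow> 'a set set \<Rightarrow> bool" where
  "simple_graph V E \<longleftrightarrow> finite V \<and> (\<forall>e\<in>E. e \<subseteq> V \<and> card e = 2)"

definition adjacent :: "'a set set \<Rightarrow> 'a \<Rightarrow> 'a \<Rightarrow> bool" where
  "adjacent E u v \<longleftrightarrow> {u, v} \<in> E"

definition degree :: "'a set set \<Rightarrow> 'a \<Rightarrow> nat" where
  "degree E v = card {e \<in> E. v \<in> e}"

definition induced_edges :: "'a set set \<Rightarrow> 'a set \<Rightarrow> 'a set set" where
  "induced_edges E S = {e \<in> E. e \<subseteq> S}"

definition components :: "'a set \<Rightarrow> 'a set set \<Rightarrow> 'a set set" where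
  "components V E = {{u. (adjacent E)\<^sup>*\<^sup>* v u} | v. v \<in> V}"

definition perfect_matching :: "'a set \<Rightarrow> 'a set set \<Rightarrow> 'a set set \<Rightarrow> bool" where
  "perfect_matching V E M \<longleftrightarrow> M \<subseteq> E \<and> (\<forall>v\<in>V. \<exists>!e. e \<in> M \<and> v \<in> e)"

definition tight :: "'a set set \<Rightarrow> 'a set \<Rightarrow> bool" where
  "tight E T \<longleftrightarrow>
     (\<forall>v\<in>T. \<exists>M. perfect_matching (T - {v}) (induced_edges E (T - {v})) M) \<and>
     (\<forall>v\<in>T. \<forall>M. perfect_matching (T - {v}) (induced_edges E (T - {v})) M \<longrightarrow>
        (\<forall>e\<in>M. \<not> (\<exists>!u. u \<in> e \<and> adjacent E u v)))"

definition tight_components :: "'a set \<Rightarrow> 'a set set \<Rightarrow> 'a set set" where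
  "tight_components V E = {T \<in> components V E. tight E T}"

definition bisection :: "'a set \<Rightarrow> 'a set \<Rightarrow> 'a set \<Rightarrow> bool" where
  "bisection V V1 V2 \<longleftrightarrow>
     V1 \<union> V2 = V \<and> V1 \<inter> V2 = {} \<and> \<bar>int (card V1) - int (card V2)\<bar> \<le> 1"

lemma isolated_vertex_tight_component:
  assumes "simple_graph V E" "v \<in> V" "\<And>e. e \<in> E \<Longrightarrow> v \<notin> e"
  shows "{v} \<in> tight_components V E"
proof -
  have na: "\<not> adjacent E v u" for u
    using assms(3) by (auto simp: adjacent_def)
  have "u = v" if "(adjacent E)\<^sup>*\<^sup>* v u" for u
    using that na by (metis converse_rtranclpE)
  then have "{u. (adjacent E)\<^sup>*\<^sup>* v u} = {v}" by auto
  then have "{v} \<in> components V E"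
    using assms(2) unfolding components_def by fastforce
  moreover have "e \<notin> induced_edges E {}" for e
    using assms(1) by (auto simp: simple_graph_def induced_edges_def)
  then have "tight E {v}"
    by (auto simp: tight_def perfect_matching_def)
  ultimately show ?thesis by (simp add: tight_components_def)
qed

end

theory Submission imports Defs begin

text \<open>The vertex set can be partitioned into at most \<open>(n + \<tau>) / 2\<close> induced stars (single vertices and
  edges included). Indeed, removing a suitable set \<open>S\<close> (Gallai--Edmonds) leaves factor-critical components, at least
  as many as there are vertices in \<open>S\<close>; one vertex of each component adjacent to \<open>S\<close> becomes a leaf of a star
  centred in \<open>S\<close> and the rest of the component is perfectly matched. The other components are components of the
  whole graph, and those that are not tight contain an induced two-edge path whose removal leaves a
  perfectly matched set.

  Colour each star by one colour at the centre and the other at the leaves, and flip the stars by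
  independent signs. The at least \<open>(n - \<tau>) / 2\<close> star edges are always cut, so the two parts contain
  \<open>m / 4 - (n - \<tau>) / 8\<close> edges on average. After high-degree leaves are split off into singletons
  (there are only few of them), all stars have total degree \<open>O(\<gamma> n)\<close>, so that second moments give
  concentration, and moving few low-degree vertices restores the balance.\<close>

subsection \<open>Maximum matchings and factor-critical components\<close>

definition matching :: "'a set set \<Rightarrow> 'a set \<Rightarrow> 'a set set \<Rightarrow> bool" where
  "matching E U M \<longleftrightarrow> M \<subseteq> induced_edges E U \<and> pairwise disjnt M"

definition max_matching :: "'a set set \<Rightarrow> 'a set \<Rightarrow> 'a set set \<Rightarrow> bool" where
  "max_matching E U M \<longleftrightarrow> matching E U M \<and> (\<forall>N. matching E U N \<longrightarrow> card N \<le> card M)"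

text \<open>Condition (i) of tightness by itself: the Gallai--Edmonds step supplies only this, and a
  failure of condition (ii) is exploited separately.\<close>

definition factor_critical :: "'a set set \<Rightarrow> 'a set \<Rightarrow> bool" where
  "factor_critical E T \<longleftrightarrow> (\<forall>v\<in>T. \<exists>M. perfect_matching (T - {v}) (induced_edges E (T - {v})) M)"

lemma simple_graph_finite_edges: "simple_graph V E \<Longrightarrow> finite E"
  by (rule finite_subset[of _ "Pow V"]) (auto simp: simple_graph_def)

lemma simple_graph_induced:
  "simple_graph V E \<Longrightarrow> U \<subseteq> V \<Longrightarrow> simple_graph U (induced_edges E U)"
  by (auto simp: simple_graph_def induced_edges_def intro: finite_subset)

lemma simple_graph_edgeE:
  assumes "simple_graph V E" "e \<in> E" "x \<in> e"
  obtains y where "e = {x, y}" "x \<noteq> y" "x \<in> V" "y \<in> V"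
proof -
  have "card e = 2" "e \<subseteq> V" using assms by (auto simp: simple_graph_def)
  with assms(3) that show thesis by (auto simp: card_2_iff)
qed

lemma matching_finite:
  "simple_graph V E \<Longrightarrow> matching E U M \<Longrightarrow> finite M"
  using simple_graph_finite_edges[of V E]
  by (auto simp: matching_def induced_edges_def intro: finite_subset)

lemma matching_card_Union:
  assumes "simple_graph V E" "matching E U M"
  shows "card (\<Union>M) = 2 * card M" "\<Union>M \<subseteq> U"
proof -
  have e: "card e = 2" if "e \<in> M" for e
    using assms that by (auto simp: matching_def induced_edges_def simple_graph_def)
  have "card (\<Union>M) = sum card M"
    using assms(2) e by (intro card_Union_disjoint) (auto simp: matching_def intro: card_ge_0_finite)
  also have "\<dots> = 2 * card M" using e by simp
  finally show "card (\<Union>M) = 2 * card M" .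
  show "\<Union>M \<subseteq> U" using assms(2) by (auto simp: matching_def induced_edges_def)
qed

lemma matching_mono: "matching E U M \<Longrightarrow> U \<subseteq> W \<Longrightarrow> matching E W M"
  by (auto simp: matching_def induced_edges_def)

lemma max_matching_exists:
  assumes "simple_graph V E"
  obtains M where "max_matching E U M"
proof -
  have "card M < Suc (card E)" if "matching E U M" for M
    using that simple_graph_finite_edges[OF assms]
    by (auto simp: matching_def induced_edges_def less_Suc_eq_le intro!: card_mono)
  moreover have "matching E U {}" by (simp add: matching_def)
  ultimately show thesis
    using ex_has_greatest_nat[of "matching E U" "{}" card "Suc (card E)"] that
    by (auto simp: max_matching_def)
qed

lemma max_matching_card_eq:
  "max_matching E U M \<Longrightarrow> max_matching E U N \<Longrightarrow> card M = card N"
  by (meson le_antisym max_matching_def)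

lemma perfect_matching_card:
  assumes "simple_graph V E" "perfect_matching W (induced_edges E W) M"
  shows "matching E W M" "\<Union>M = W" "card W = 2 * card M"
proof -
  show M: "matching E W M"
    using assms(2) unfolding matching_def perfect_matching_def pairwise_def disjnt_def induced_edges_def
    by blast
  show U: "\<Union>M = W"
    using assms(2) unfolding perfect_matching_def induced_edges_def by blast
  show "card W = 2 * card M" using matching_card_Union(1)[OF assms(1) M] U by simp
qed

lemma perfect_matchingI:
  assumes "matching E W M" "W \<subseteq> \<Union>M"
  shows "perfect_matching W (induced_edges E W) M"
proof -
  have "\<exists>!e. e \<in> M \<and> v \<in> e" if "v \<in> W" for v
  proof -
    obtain e where e: "e \<in> M" "v \<in> e" using assms(2) \<open>v \<in> W\<close> by blast
    moreover have "f = e" if "f \<in> M" "v \<in> f" for f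
      using that e assms(1) pairwiseD[of disjnt M e f] by (auto simp: matching_def disjnt_def)
    ultimately show ?thesis by blast
  qed
  then show ?thesis using assms(1) by (simp add: perfect_matching_def matching_def)
qed

text \<open>Exchanging one edge of \<open>N\<close> for an edge of \<open>M\<close> brings \<open>N\<close> closer to \<open>M\<close>,
  which replaces the usual argument with alternating paths.\<close>

lemma max_matching_misses_trans:
  assumes G: "simple_graph V E"
    and M: "max_matching E U M" "u \<notin> \<Union>M" "v \<notin> \<Union>M" "u \<noteq> v"
    and ut: "\<And>N. max_matching E U N \<Longrightarrow> t \<notin> \<Union>N \<Longrightarrow> u \<in> \<Union>N"
    and vt: "\<And>N. max_matching E U N \<Longrightarrow> t \<notin> \<Union>N \<Longrightarrow> v \<in> \<Union>N"
    and N: "max_matching E U N"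
  shows "t \<in> \<Union>N"
  using N
proof (induction "card (M - N)" arbitrary: N rule: less_induct)
  case less
  show ?case
  proof (rule ccontr)
    assume t: "t \<notin> \<Union>N"
    have mM: "matching E U M" and mN: "matching E U N"
      using M(1) less.prems by (auto simp: max_matching_def)
    have fin: "finite M" "finite N" using matching_finite[OF G] mM mN by auto
    have card2: "card e = 2" if "e \<in> M \<union> N" for e
      using that mM mN G by (auto simp: matching_def induced_edges_def simple_graph_def)
    have finU: "finite (\<Union>M)" "finite (\<Union>N)"
      using fin card2 by (metis UnCI card.infinite finite_Union zero_neq_numeral)+
    have "card (\<Union>M) = card (\<Union>N)"
      using matching_card_Union(1)[OF G] mM mN max_matching_card_eq[OF M(1) less.prems] by simp
    \<comment> \<open>Both matchings cover equally many vertices, and \<open>N\<close> covers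
      \<open>u\<close> and \<open>v\<close> while \<open>M\<close> does not; so \<open>M\<close>
      covers at least two vertices missed by \<open>N\<close>, one of them different from
      \<open>t\<close>.\<close>
    then have "card (\<Union>M - \<Union>N) = card (\<Union>N - \<Union>M)"
      using finU by (metis Int_commute card_Diff_subset_Int finite_Int)
    moreover have "card {u, v} \<le> card (\<Union>N - \<Union>M)"
      using M ut[OF less.prems t] vt[OF less.prems t] finU by (intro card_mono) auto
    ultimately have "2 \<le> card (\<Union>M - \<Union>N)" using M(4) by simp
    then have "\<not> \<Union>M - \<Union>N \<subseteq> {t}"
      using card_mono[of "{t}" "\<Union>M - \<Union>N"] by auto
    then obtain x e where x: "e \<in> M" "x \<in> e" "x \<notin> \<Union>N" "x \<noteq> t" by blast
    obtain y where y: "e = {x, y}" "x \<noteq> y"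
      using simple_graph_edgeE[OF G, of e x] x mM by (auto simp: matching_def induced_edges_def)
    have eU: "e \<in> induced_edges E U" using x mM by (auto simp: matching_def)
    have "y \<in> \<Union>N"
    proof (rule ccontr)
      assume "y \<notin> \<Union>N"
      then have "matching E U (insert e N)"
        using mN x y eU by (auto simp: matching_def pairwise_insert disjnt_def)
      then have "card (insert e N) \<le> card N" using less.prems by (auto simp: max_matching_def)
      then show False using x fin by (auto simp: card_insert_if split: if_splits)
    qed
    then obtain f where f: "f \<in> N" "y \<in> f" by blast
    \<comment> \<open>The swap keeps the size, so \<open>N'\<close> is again maximum, and it still
      misses \<open>t\<close>, since neither \<open>x\<close> nor \<open>y\<close> is
      \<open>t\<close>. It gains an edge of \<open>M\<close> and loses \<open>f\<close>, which is
      not in \<open>M\<close>, so the induction measure drops.\<close>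
    define N' where "N' = insert e (N - {f})"
    have eN: "e \<notin> N" using x by blast
    have "matching E U N'"
      unfolding matching_def N'_def pairwise_insert
    proof (intro conjI ballI impI)
      show "insert e (N - {f}) \<subseteq> induced_edges E U" using eU mN by (auto simp: matching_def)
      show "pairwise disjnt (N - {f})" using mN by (auto simp: matching_def pairwise_def)
      have *: "disjnt e g" if "g \<in> N - {f}" for g
        using that mN f x y unfolding matching_def pairwise_def disjnt_def by blast
      show "\<forall>g. g \<in> N - {f} \<and> g \<noteq> e \<longrightarrow> disjnt e g \<and> disjnt g e"
        using * by (auto simp: disjnt_sym)
    qed
    moreover have cN': "card N' = card N"
      unfolding N'_def using eN f fin by (simp add: card_Suc_Diff1 del: card_Diff_singleton card_Diff_insert)
    ultimately have mx: "max_matching E U N'" using less.prems by (simp add: max_matching_def)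
    have "e \<noteq> f" using x f by blast
    moreover have "\<not> disjnt e f" using y f by (auto simp: disjnt_def)
    ultimately have "f \<notin> M"
      using mM x(1) by (auto simp: matching_def dest: pairwiseD)
    then have "M - N' = (M - N) - {e}" unfolding N'_def by blast
    then have "card (M - N') < card (M - N)"
      using x eN fin by (metis DiffI card_Diff1_less finite_Diff)
    then have "t \<in> \<Union>N'" using less.hyps mx by blast
    then show False using t x y f unfolding N'_def by blast
  qed
qed

section \<open>Components and the Gallai--Edmonds decomposition\<close>

lemma components_partition:
  assumes "simple_graph U F"
  shows "\<Union>(components U F) = U" "pairwise disjnt (components U F)"
    "\<And>T. T \<in> components U F \<Longrightarrow> T \<noteq> {}" "finite (components U F)"
proof -
  have sym: "(adjacent F)\<^sup>*\<^sup>* u v \<Longrightarrow> (adjacent F)\<^sup>*\<^sup>* v u" for u v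
    by (rule sympD[OF symp_rtranclp]) (auto intro!: sympI simp: adjacent_def insert_commute)
  have sub: "u \<in> U" if "(adjacent F)\<^sup>*\<^sup>* v u" "v \<in> U" for u v
    using that assms by (induction rule: rtranclp_induct) (auto simp: adjacent_def simple_graph_def)
  show "\<Union>(components U F) = U" using sub by (auto simp: components_def)
  show "pairwise disjnt (components U F)"
  proof (rule pairwiseI)
    fix A B assume "A \<in> components U F" "B \<in> components U F" and ne: "A \<noteq> B"
    then obtain a b where ab: "A = {u. (adjacent F)\<^sup>*\<^sup>* a u}" "B = {u. (adjacent F)\<^sup>*\<^sup>* b u}"
      by (auto simp: components_def)
    have "A = B" if "x \<in> A" "x \<in> B" for x
    proof -
      have x: "(adjacent F)\<^sup>*\<^sup>* a x" "(adjacent F)\<^sup>*\<^sup>* b x" using that ab by auto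
      have "(adjacent F)\<^sup>*\<^sup>* a b" "(adjacent F)\<^sup>*\<^sup>* b a"
        using rtranclp_trans[OF x(1) sym[OF x(2)]] rtranclp_trans[OF x(2) sym[OF x(1)]] .
      then show ?thesis unfolding ab by (blast intro: rtranclp_trans)
    qed
    with ne show "disjnt A B" by (auto simp: disjnt_def)
  qed
  show "T \<noteq> {}" if "T \<in> components U F" for T using that by (auto simp: components_def)
  have "components U F = (\<lambda>v. {u. (adjacent F)\<^sup>*\<^sup>* v u}) ` U" by (auto simp: components_def)
  then show "finite (components U F)" using assms by (simp add: simple_graph_def)
qed

lemma components_edge:
  assumes "simple_graph U F" "T \<in> components U F" "e \<in> F" "e \<inter> T \<noteq> {}"
  shows "e \<subseteq> T"
proof -
  obtain x where x: "x \<in> e" "x \<in> T" using assms by blast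
  obtain y where y: "e = {x, y}" using simple_graph_edgeE[OF assms(1,3) x(1)] by metis
  have "adjacent F x y" using y assms by (simp add: adjacent_def)
  then show ?thesis using x y assms(2)
    by (auto simp: components_def intro: rtranclp.rtrancl_into_rtrancl)
qed

lemma induced_edges_induced:
  "W \<subseteq> U \<Longrightarrow> induced_edges (induced_edges E U) W = induced_edges E W"
  by (auto simp: induced_edges_def)

lemma factor_critical_induced:
  "T \<subseteq> U \<Longrightarrow> factor_critical (induced_edges E U) T \<longleftrightarrow> factor_critical E T"
  by (simp add: factor_critical_def induced_edges_induced subset_eq)

text \<open>Induction along a path from \<open>u\<close> to \<open>v\<close>. A maximum matching
  cannot miss both ends of an edge. If one missed both \<open>u\<close> and \<open>v\<close>, the
  exchange lemma applied to the penultimate vertex \<open>t\<close> would put \<open>t\<close> into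
  every maximum matching, against inessentiality.\<close>

lemma max_matching_misses_unique:
  assumes G: "simple_graph V E"
    and inessential: "\<And>t. t \<in> V \<Longrightarrow> \<exists>N. max_matching E V N \<and> t \<notin> \<Union>N"
    and "(adjacent E)\<^sup>*\<^sup>* u v" "u \<noteq> v" "max_matching E V M" "u \<notin> \<Union>M"
  shows "v \<in> \<Union>M"
  using assms(3-)
proof (induction arbitrary: M rule: rtranclp_induct)
  case (step t v)
  have edge: "v \<in> \<Union>N" if N: "max_matching E V N" "t \<notin> \<Union>N" for N
  proof (rule ccontr)
    assume v: "v \<notin> \<Union>N"
    have e: "{t, v} \<in> induced_edges E V"
      using step.hyps(2) G by (auto simp: adjacent_def induced_edges_def simple_graph_def)
    then have "matching E V (insert {t, v} N)"
      using N v by (auto simp: max_matching_def matching_def pairwise_insert disjnt_def)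
    then have "card (insert {t, v} N) \<le> card N" using N by (auto simp: max_matching_def)
    moreover have "finite N" using matching_finite[OF G] N by (auto simp: max_matching_def)
    ultimately show False using N v by (auto simp: card_insert_if split: if_splits)
  qed
  have t: "t \<in> V" using step.hyps(2) G by (auto simp: adjacent_def simple_graph_def)
  show ?case
  proof (cases "t = u")
    case True
    then show ?thesis using edge step.prems by blast
  next
    case False
    show ?thesis
    proof (rule ccontr)
      assume "v \<notin> \<Union>M"
      then have "t \<in> \<Union>N" if "max_matching E V N" for N
        using max_matching_misses_trans[OF G step.prems(2,3) _ step.prems(1) _ edge that]
          step.IH False by blast
      then show False using inessential[OF t] by blast
    qed
  qed
qed simp

text \<open>A maximum matching misses at most one vertex per component. One that misses
  \<open>v\<close> therefore matches the rest of the component of \<open>v\<close> within that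
  component, and for any maximum matching the missed vertices inject into the components.\<close>

lemma gallai:
  assumes G: "simple_graph V E"
    and inessential: "\<And>t. t \<in> V \<Longrightarrow> \<exists>N. max_matching E V N \<and> t \<notin> \<Union>N"
    and M: "max_matching E V M"
  shows "\<forall>T\<in>components V E. factor_critical E T"
    and "card V \<le> 2 * card M + card (components V E)"
proof -
  note unique = max_matching_misses_unique[OF G inessential]
  show "\<forall>T\<in>components V E. factor_critical E T"
    unfolding factor_critical_def
  proof (intro ballI)
    fix T v assume T: "T \<in> components V E" and v: "v \<in> T"
    have "v \<in> V" using components_partition(1)[OF G] T v by blast
    then obtain N where N: "max_matching E V N" "v \<notin> \<Union>N" using inessential by blast
    have mN: "matching E V N" using N by (simp add: max_matching_def)
    define N' where "N' = {e \<in> N. e \<subseteq> T}"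
    have "matching E (T - {v}) N'"
      using mN N unfolding matching_def N'_def pairwise_def induced_edges_def by auto
    moreover have "T - {v} \<subseteq> \<Union>N'"
    proof
      fix w assume w: "w \<in> T - {v}"
      have "(adjacent E)\<^sup>*\<^sup>* v w"
      proof -
        obtain a where a: "T = {u. (adjacent E)\<^sup>*\<^sup>* a u}" using T by (auto simp: components_def)
        have "symp (adjacent E)" by (auto intro!: sympI simp: adjacent_def insert_commute)
        then have "(adjacent E)\<^sup>*\<^sup>* v a" using a v by (auto dest: sympD[OF symp_rtranclp])
        then show ?thesis using a w by (auto intro: rtranclp_trans)
      qed
      then have "w \<in> \<Union>N" using unique[OF _ _ _ N] w by blast
      then obtain e where e: "e \<in> N" "w \<in> e" by blast
      then have "e \<in> E" using mN by (auto simp: matching_def induced_edges_def)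
      then have "e \<subseteq> T" using components_edge[OF G T] e w by blast
      then show "w \<in> \<Union>N'" using e by (auto simp: N'_def)
    qed
    ultimately show "\<exists>M. perfect_matching (T - {v}) (induced_edges E (T - {v})) M"
      using perfect_matchingI by blast
  qed
  have mM: "matching E V M" using M by (simp add: max_matching_def)
  have finV: "finite V" using G by (simp add: simple_graph_def)
  have "card (V - \<Union>M) \<le> card (components V E)"
  proof (rule card_inj_on_le[OF _ _ components_partition(4)[OF G]])
    show "(\<lambda>v. {u. (adjacent E)\<^sup>*\<^sup>* v u}) ` (V - \<Union>M) \<subseteq> components V E"
      by (auto simp: components_def)
    show "inj_on (\<lambda>v. {u. (adjacent E)\<^sup>*\<^sup>* v u}) (V - \<Union>M)"
    proof (rule inj_onI)
      fix x y assume xy: "x \<in> V - \<Union>M" "y \<in> V - \<Union>M"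
        and eq: "{u. (adjacent E)\<^sup>*\<^sup>* x u} = {u. (adjacent E)\<^sup>*\<^sup>* y u}"
      have "y \<in> {u. (adjacent E)\<^sup>*\<^sup>* x u}" unfolding eq by simp
      then show "x = y" using unique[OF _ _ _ M, of x y] xy by auto
    qed
  qed
  then show "card V \<le> 2 * card M + card (components V E)"
    using matching_card_Union[OF G mM] finV by (simp add: card_Diff_subset finite_subset)
qed

text \<open>Vertices covered by every maximum matching are moved into \<open>S\<close> one at a time
  until none is left, and then Gallai's lemma applies. The inequality is the Tutte--Berge bound in
  additive form.\<close>

lemma gallai_edmonds:
  assumes "simple_graph V E"
  shows "\<exists>S M. S \<subseteq> V \<and> matching E V M \<and>
    (\<forall>T\<in>components (V - S) (induced_edges E (V - S)). factor_critical E T) \<and>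
    card V + card S \<le> 2 * card M + card (components (V - S) (induced_edges E (V - S)))"
  using assms
proof (induction "card V" arbitrary: V E rule: less_induct)
  case less
  note G = less.prems
  have finV: "finite V" using G by (simp add: simple_graph_def)
  obtain M where M: "max_matching E V M" by (rule max_matching_exists[OF G])
  have mM: "matching E V M" using M by (simp add: max_matching_def)
  show ?case
  proof (cases "\<forall>t\<in>V. \<exists>N. max_matching E V N \<and> t \<notin> \<Union>N")
    case True
    have "induced_edges E V = E" using G by (auto simp: induced_edges_def simple_graph_def)
    then show ?thesis using gallai[OF G _ M] True mM
      by (intro exI[of _ "{}"] exI[of _ M]) auto
  next
    case False
    then obtain s where s: "s \<in> V" "\<And>N. max_matching E V N \<Longrightarrow> s \<in> \<Union>N" by blast
    define U where "U = V - {s}"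
    have U: "U \<subseteq> V" "card V = Suc (card U)" "s \<notin> U"
      using s finV by (auto simp: U_def card_Suc_Diff1 simp del: card_Diff_singleton card_Diff_insert)
    then obtain S N where SN: "S \<subseteq> U" "matching (induced_edges E U) U N"
      "\<forall>T\<in>components (U - S) (induced_edges E (U - S)). factor_critical (induced_edges E U) T"
      "card U + card S \<le> 2 * card N + card (components (U - S) (induced_edges E (U - S)))"
      using less.hyps[OF _ simple_graph_induced[OF G U(1)]]
      by (auto simp: induced_edges_induced)
    have mN: "matching E U N" using SN(2) by (auto simp: matching_def induced_edges_def)
    then have mN': "matching E V N" using U(1) matching_mono by blast
    have "s \<notin> \<Union>N" using matching_card_Union(2)[OF G mN] U(3) by blast
    \<comment> \<open>Returning \<open>s\<close> raises the left side of the inequality by two, one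
      for \<open>V\<close> and one for \<open>S\<close>; the strictly larger matching
      \<open>M\<close> pays for this.\<close>
    then have "\<not> max_matching E V N" using s(2) by blast
    then have lt: "card N < card M"
      using M mN' unfolding max_matching_def by (metis le_trans linorder_not_less)
    have eq: "V - insert s S = U - S" by (auto simp: U_def)
    have "factor_critical E T" if "T \<in> components (U - S) (induced_edges E (U - S))" for T
    proof -
      have "T \<subseteq> U" using components_partition(1)[OF simple_graph_induced[OF G, of "U - S"]] that U(1)
        by blast
      then show ?thesis using SN(3) that factor_critical_induced by blast
    qed
    moreover have "card (insert s S) = Suc (card S)"
      using SN(1) U finV by (meson card_insert_disjoint finite_subset subsetD)
    ultimately show ?thesis
      using lt SN(1,4) U s mM by (intro exI[of _ "insert s S"] exI[of _ M]) (auto simp: eq)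
  qed
qed

subsection \<open>Partitions into induced stars\<close>

text \<open>A partition into induced stars is encoded by the map that sends each vertex to the centre of
  its star; the stars correspond to the fixed points.\<close>

definition star_map :: "'a set \<Rightarrow> 'a set set \<Rightarrow> ('a \<Rightarrow> 'a) \<Rightarrow> bool" where
  "star_map V E c \<longleftrightarrow>
     (\<forall>v\<in>V. c v \<in> V \<and> c (c v) = c v \<and> (c v \<noteq> v \<longrightarrow> {v, c v} \<in> E)) \<and>
     (\<forall>u\<in>V. \<forall>v\<in>V. c u \<noteq> u \<longrightarrow> c v \<noteq> v \<longrightarrow> c u = c v \<longrightarrow> {u, v} \<notin> E)"

lemma simple_graph_no_loop: "simple_graph V E \<Longrightarrow> {v, v} \<notin> E"
  by (auto simp: simple_graph_def)

lemma perfect_matching_star_map: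
  assumes G: "simple_graph V E" and pm: "perfect_matching W (induced_edges E W) M"
  obtains c where "star_map W E c" "2 * card {v\<in>W. c v = v} \<le> card W"
proof -
  define e where "e v = (THE e. e \<in> M \<and> v \<in> e)" for v
  have ex: "\<exists>!e. e \<in> M \<and> v \<in> e" if "v \<in> W" for v
    using pm that by (auto simp: perfect_matching_def)
  have e: "e v \<in> M" "v \<in> e v" if "v \<in> W" for v
    using theI'[OF ex[OF that]] by (auto simp: e_def)
  have e_eq: "e v = f" if "f \<in> M" "v \<in> f" "v \<in> W" for f v
    using that ex[OF that(3)] e[OF that(3)] by blast
  have ME: "f \<in> E" "f \<subseteq> W" if "f \<in> M" for f
    using pm that by (auto simp: perfect_matching_def induced_edges_def)
  have card2: "card f = 2" if "f \<in> M" for f using ME[OF that] G by (auto simp: simple_graph_def)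
  \<comment> \<open>Every matching edge is a star, with an arbitrary endpoint as its centre.\<close>
  define r where "r f = (SOME x. x \<in> f)" for f :: "'a set"
  have r: "r f \<in> f" if "f \<in> M" for f
    using card2[OF that] by (auto simp: r_def some_in_eq)
  define c where "c v = r (e v)" for v
  have c: "c v \<in> W" "c v \<in> e v" "e (c v) = e v" if "v \<in> W" for v
    using r[OF e(1)[OF that]] ME(2)[OF e(1)[OF that]] e_eq[OF e(1)[OF that], of "c v"]
    by (auto simp: c_def)
  have edge: "e v = {v, c v}" if "v \<in> W" "c v \<noteq> v" for v
    using card2[OF e(1)[OF that(1)]] e(2)[OF that(1)] c(2)[OF that(1)] that(2)
    by (auto simp: card_2_iff)
  have "star_map W E c"
    unfolding star_map_def
  proof (intro conjI ballI impI)
    fix v assume v: "v \<in> W"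
    show "c v \<in> W" using c v by blast
    show "c (c v) = c v" using c(3)[OF v] by (simp add: c_def)
    show "{v, c v} \<in> E" if "c v \<noteq> v" using edge[OF v that] e(1)[OF v] ME by auto
  next
    fix u v assume uv: "u \<in> W" "v \<in> W" "c u \<noteq> u" "c v \<noteq> v" "c u = c v"
    have "e u = e v" using c(3) uv by metis
    then have "u = v" using edge uv by (metis doubleton_eq_iff)
    then show "{u, v} \<notin> E" using simple_graph_no_loop[OF G] by simp
  qed
  moreover have "card {v\<in>W. c v = v} \<le> card M"
  proof -
    have "{v\<in>W. c v = v} \<subseteq> r ` M" using e(1) by (force simp: c_def)
    moreover have "finite M" using matching_finite[OF G perfect_matching_card(1)[OF G pm]] .
    ultimately show ?thesis by (meson card_image_le card_mono finite_imageI le_trans)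
  qed
  ultimately show thesis using that perfect_matching_card(3)[OF G pm] by simp
qed

text \<open>Parity: deleting a vertex of \<open>T\<close> leaves a perfectly matched set, so
  \<open>T\<close> is odd, whereas edges of \<open>M\<close> meeting \<open>T\<close> stay inside
  \<open>T\<close> and cover an even number of vertices.\<close>

lemma tight_component_exposed:
  assumes G: "simple_graph V E" and M: "matching E V M" and T: "T \<in> tight_components V E"
  shows "\<not> T \<subseteq> \<Union>M"
proof
  assume sub: "T \<subseteq> \<Union>M"
  have TC: "T \<in> components V E" and tight: "tight E T"
    using T by (auto simp: tight_components_def)
  have TV: "T \<subseteq> V" using components_partition(1)[OF G] TC by blast
  then have finT: "finite T" using G by (auto simp: simple_graph_def intro: finite_subset)
  obtain v where v: "v \<in> T" using components_partition(3)[OF G TC] by blast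
  obtain N where "perfect_matching (T - {v}) (induced_edges E (T - {v})) N"
    using tight v by (auto simp: tight_def)
  then have "even (card (T - {v}))" using perfect_matching_card(3)[OF G] by simp
  moreover have "card T = Suc (card (T - {v}))" by (rule card.remove[OF finT v])
  ultimately have odd: "odd (card T)" by simp
  define M' where "M' = {e \<in> M. e \<subseteq> T}"
  have "matching E T M'"
    using M unfolding matching_def M'_def pairwise_def induced_edges_def by auto
  moreover have "T \<subseteq> \<Union>M'"
  proof
    fix w assume w: "w \<in> T"
    then obtain e where e: "e \<in> M" "w \<in> e" using sub by blast
    then have "e \<subseteq> T"
      using components_edge[OF G TC] w M by (auto simp: matching_def induced_edges_def)
    then show "w \<in> \<Union>M'" using e by (auto simp: M'_def)
  qed
  ultimately have "card T = 2 * card M'"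
    using matching_card_Union[OF G] by (metis subset_antisym)
  then show False using odd by simp
qed

text \<open>Each tight component contains an unmatched vertex, and components are disjoint. This
  trades the matching size for \<open>\<tau>\<close> at the end of
  \<open>star_map_exists\<close>.\<close>

lemma card_tight_components_le:
  assumes G: "simple_graph V E" and M: "matching E V M"
  shows "card (tight_components V E) + 2 * card M \<le> card V"
proof -
  have finV: "finite V" using G by (simp add: simple_graph_def)
  have sub: "tight_components V E \<subseteq> components V E" by (auto simp: tight_components_def)
  have "\<forall>T\<in>tight_components V E. \<exists>x. x \<in> T - \<Union>M"
    using tight_component_exposed[OF G M] by blast
  then obtain g where g: "\<And>T. T \<in> tight_components V E \<Longrightarrow> g T \<in> T - \<Union>M" by metis
  have "card (tight_components V E) \<le> card (V - \<Union>M)"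
  proof (rule card_inj_on_le)
    show "inj_on g (tight_components V E)"
    proof (rule inj_onI)
      fix T T' assume "T \<in> tight_components V E" "T' \<in> tight_components V E" "g T = g T'"
      then show "T = T'"
        using g[of T] g[of T'] pairwiseD[OF components_partition(2)[OF G], of T T'] sub
        by (auto simp: disjnt_def)
    qed
    show "g ` tight_components V E \<subseteq> V - \<Union>M"
      using g sub components_partition(1)[OF G] by blast
    show "finite (V - \<Union>M)" using finV by simp
  qed
  moreover have "card (V - \<Union>M) = card V - 2 * card M" "2 * card M \<le> card V"
    using matching_card_Union[OF G M] finV
    by (simp_all add: card_Diff_subset finite_subset card_mono flip: matching_card_Union(1)[OF G M])
  ultimately show ?thesis by linarith
qed

text \<open>A walk in the whole graph that starts in \<open>T\<close> cannot leave it. This lets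
  components of \<open>V - S\<close> without neighbours in \<open>S\<close> be compared with
  \<open>tight_components V E\<close>.\<close>

lemma component_isolated:
  assumes G: "simple_graph V E" and T: "T \<in> components U (induced_edges E U)" and U: "U \<subseteq> V"
    and iso: "\<And>x s. x \<in> T \<Longrightarrow> s \<in> V - U \<Longrightarrow> {x, s} \<notin> E"
  shows "T \<in> components V E"
proof -
  let ?a = "adjacent E" and ?b = "adjacent (induced_edges E U)"
  obtain v where v: "v \<in> U" "T = {u. ?b\<^sup>*\<^sup>* v u}" using T by (auto simp: components_def)
  have "?b \<le> ?a" by (auto simp: adjacent_def induced_edges_def)
  then have "T \<subseteq> {u. ?a\<^sup>*\<^sup>* v u}" using v by (auto dest: rtranclp_mono)
  moreover have "u \<in> T" if "?a\<^sup>*\<^sup>* v u" for u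
    using that
  proof (induction rule: rtranclp_induct)
    case base
    show ?case using v by simp
  next
    case (step y z)
    have "T \<subseteq> U" using components_partition(1)[OF simple_graph_induced[OF G U]] T by blast
    moreover have "z \<in> V" using step.hyps(2) G by (auto simp: adjacent_def simple_graph_def)
    ultimately have "?b y z"
      using step iso[of y z] by (auto simp: adjacent_def induced_edges_def)
    then show ?case using step.IH v by (auto intro: rtranclp.rtrancl_into_rtrancl)
  qed
  ultimately have "T = {u. ?a\<^sup>*\<^sup>* v u}" by blast
  then show ?thesis using v(1) U by (auto simp: components_def)
qed

text \<open>The matching edges left after deleting \<open>v\<close> serve as stars. The vertex
  \<open>v\<close> stays unassigned, to become either a leaf of an outside star or a
  singleton.\<close>

lemma factor_critical_star_map:
  assumes G: "simple_graph V E" and fc: "factor_critical E T" and v: "v \<in> T" and T: "T \<subseteq> V"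
  obtains c where "star_map (T - {v}) E c" "2 * card {u\<in>T - {v}. c u = u} + 1 \<le> card T"
proof -
  obtain M where M: "perfect_matching (T - {v}) (induced_edges E (T - {v})) M"
    using fc v by (auto simp: factor_critical_def)
  have "finite T" using G T by (auto simp: simple_graph_def intro: finite_subset)
  then have "card T = Suc (card (T - {v}))" using v by (intro card.remove)
  moreover obtain c where "star_map (T - {v}) E c" "2 * card {u\<in>T - {v}. c u = u} \<le> card (T - {v})"
    using perfect_matching_star_map[OF G M] by blast
  ultimately show thesis using that by simp
qed

text \<open>A failure of condition (ii) gives a matching edge \<open>{x, y}\<close> with
  \<open>x\<close> adjacent to \<open>v\<close> and \<open>y\<close> not. Then \<open>v\<close>,
  \<open>x\<close>, \<open>y\<close> form an induced path, a star centred at \<open>x\<close>, and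
  the other matching edges cover the rest. One centre for three vertices saves the half centre
  needed for the bound.\<close>

lemma not_tight_star_map:
  assumes G: "simple_graph V E" and fc: "factor_critical E T" and T: "T \<subseteq> V" "\<not> tight E T"
  obtains c where "star_map T E c" "2 * card {u\<in>T. c u = u} + 1 \<le> card T"
proof -
  have finT: "finite T" using G T by (auto simp: simple_graph_def intro: finite_subset)
  obtain v M e where v: "v \<in> T" and M: "perfect_matching (T - {v}) (induced_edges E (T - {v})) M"
    and e: "e \<in> M" "\<exists>!u. u \<in> e \<and> adjacent E u v"
    using fc T(2) unfolding tight_def factor_critical_def by blast
  obtain x where x: "x \<in> e" "{x, v} \<in> E" using e by (auto simp: adjacent_def)
  have eE: "e \<in> E" "e \<subseteq> T - {v}" using M e(1) by (auto simp: perfect_matching_def induced_edges_def)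
  obtain y where y: "e = {x, y}" "x \<noteq> y" using simple_graph_edgeE[OF G eE(1) x(1)] by metis
  have yv: "{y, v} \<notin> E" using e(2) x y by (auto simp: adjacent_def)
  define W where "W = T - {v, x, y}"
  have "perfect_matching W (induced_edges E W) (M - {e})"
  proof (rule perfect_matchingI)
    note mM = perfect_matching_card(1,2)[OF G M]
    have dis: "f \<inter> e = {}" if "f \<in> M - {e}" for f
      using that mM(1) e(1) pairwiseD[of disjnt M f e] by (auto simp: matching_def disjnt_def)
    show "matching E W (M - {e})"
      unfolding matching_def
    proof
      show "M - {e} \<subseteq> induced_edges E W"
      proof
        fix f assume f: "f \<in> M - {e}"
        then have "f \<in> E" "f \<subseteq> T - {v}" using mM(1) by (auto simp: matching_def induced_edges_def)
        then show "f \<in> induced_edges E W" using dis[OF f] y by (auto simp: induced_edges_def W_def)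
      qed
      show "pairwise disjnt (M - {e})" using mM(1) by (auto simp: matching_def pairwise_def)
    qed
    show "W \<subseteq> \<Union>(M - {e})" using mM(2) y unfolding W_def by blast
  qed
  then obtain c where c: "star_map W E c" "2 * card {u\<in>W. c u = u} \<le> card W"
    using perfect_matching_star_map[OF G] by blast
  define d where "d = c(v := x, x := x, y := x)"
  have vxy: "v \<noteq> x" "v \<noteq> y" "x \<in> T" "y \<in> T" using eE(2) y by auto
  have dW: "d u = c u" "c u \<in> W" "u \<noteq> v" "u \<noteq> x" "u \<noteq> y" "d (c u) = c (c u)" if "u \<in> W" for u
    using that c(1) by (auto simp: d_def W_def star_map_def)
  have dx: "d v = x" "d x = x" "d y = x" using vxy y(2) by (auto simp: d_def)
  have split: "u \<in> W \<or> u = v \<or> u = x \<or> u = y" if "u \<in> T" for u using that by (auto simp: W_def)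
  have xW: "x \<notin> W" by (simp add: W_def)
  have WT: "u \<in> T" if "u \<in> W" for u using that by (simp add: W_def)
  have "star_map T E d"
    unfolding star_map_def
  proof (intro conjI ballI impI)
    fix u assume u: "u \<in> T"
    show "d u \<in> T" using split[OF u] dW dx vxy WT by metis
    show "d (d u) = d u" using split[OF u] dW dx c(1) unfolding star_map_def by metis
    show "{u, d u} \<in> E" if "d u \<noteq> u"
      using split[OF u] that dW[of u] dx c(1) x(2) eE(1) y(1)
      by (auto simp: star_map_def insert_commute)
  next
    fix u w assume uw: "u \<in> T" "w \<in> T" "d u \<noteq> u" "d w \<noteq> w" "d u = d w"
    \<comment> \<open>The map sends \<open>W\<close> into \<open>W\<close>, while \<open>v\<close>
      and \<open>y\<close> go to \<open>x\<close> outside \<open>W\<close>, so two leaves with a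
      common centre lie on the same side.\<close>
    consider "u \<in> W" "w \<in> W" | "u \<in> {v, y}" "w \<in> {v, y}"
      using split[OF uw(1)] split[OF uw(2)] uw(3-5) dx dW xW by (metis insertI1 insertI2)
    then show "{u, w} \<notin> E"
    proof cases
      case 1
      then show ?thesis using uw dW c(1) by (auto simp: star_map_def)
    next
      case 2
      then show ?thesis using yv simple_graph_no_loop[OF G] by (auto simp: insert_commute)
    qed
  qed
  moreover have "card {u\<in>T. d u = u} \<le> Suc (card {u\<in>W. c u = u})"
  proof -
    have "finite W" using finT by (simp add: W_def)
    moreover have "{u\<in>T. d u = u} \<subseteq> insert x {u\<in>W. c u = u}"
    proof
      fix u assume u: "u \<in> {u\<in>T. d u = u}"
      then show "u \<in> insert x {u\<in>W. c u = u}"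
        using split[of u] dW(1)[of u] dx vxy y(2) by auto
    qed
    ultimately have "card {u\<in>T. d u = u} \<le> card (insert x {u\<in>W. c u = u})"
      by (intro card_mono) auto
    then show ?thesis using \<open>finite W\<close> xW by simp
  qed
  moreover have "card T = card W + 3"
  proof -
    have "{v, x, y} \<subseteq> T" "card {v, x, y} = 3" using v vxy y(2) by auto
    then show ?thesis unfolding W_def
      using finT by (metis card_Diff_subset card_mono finite_subset le_add_diff_inverse2)
  qed
  ultimately show thesis using that c(2) by simp
qed

text \<open>Each star costs one centre. Absorbing a factor-critical component of \<open>V - S\<close> into
  a star centred in \<open>S\<close>, or into a three-vertex path when it is not tight, needs no more than
  \<open>(card T - 1) / 2\<close> new centres; only tight components need one more.\<close>

lemma component_star_map:
  assumes G: "simple_graph V E" and S: "S \<subseteq> V"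
    and T: "T \<in> components (V - S) (induced_edges E (V - S))" and fc: "factor_critical E T"
  shows "\<exists>c. (\<forall>v\<in>T. c v \<in> T \<union> S \<and> (c v \<in> T \<longrightarrow> c (c v) = c v) \<and> (c v \<noteq> v \<longrightarrow> {v, c v} \<in> E)) \<and>
    (\<forall>u\<in>T. \<forall>v\<in>T. c u \<noteq> u \<longrightarrow> c v \<noteq> v \<longrightarrow> c u = c v \<longrightarrow> {u, v} \<notin> E) \<and>
    2 * card {v\<in>T. c v = v} + 1 \<le> card T + (if T \<in> tight_components V E then 2 else 0)"
proof -
  note H = simple_graph_induced[OF G, of "V - S"]
  have TVS: "T \<subseteq> V - S" using components_partition(1)[OF H] T by blast
  then have TV: "T \<subseteq> V" by blast
  have finT: "finite T" using G TV by (auto simp: simple_graph_def intro: finite_subset)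
  note loop = simple_graph_no_loop[OF G]
  show ?thesis
  proof (cases "\<exists>w s. w \<in> T \<and> s \<in> S \<and> {w, s} \<in> E")
    case True
    then obtain w s where ws: "w \<in> T" "s \<in> S" "{w, s} \<in> E" by blast
    obtain c where c: "star_map (T - {w}) E c" "2 * card {u\<in>T - {w}. c u = u} + 1 \<le> card T"
      using factor_critical_star_map[OF G fc ws(1) TV] by blast
    have sT: "s \<notin> T" using ws TVS by blast
    \<comment> \<open>The vertex \<open>w\<close> hangs on the existing centre \<open>s\<close>, so
      only the matching edges of \<open>T - {w}\<close> cost centres.\<close>
    define d where "d = c(w := s)"
    have d: "d w = s" "\<And>u. u \<noteq> w \<Longrightarrow> d u = c u" by (auto simp: d_def)
    have ct: "c u \<in> T" "c u \<noteq> w" "c (c u) = c u" "c u \<noteq> u \<Longrightarrow> {u, c u} \<in> E" if "u \<in> T" "u \<noteq> w" for u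
      using c(1) that by (auto simp: star_map_def)
    have "d u = u \<longleftrightarrow> u \<noteq> w \<and> c u = u" if "u \<in> T" for u
      using d ws sT that by (cases "u = w") auto
    then have "{v\<in>T. d v = v} = {u\<in>T - {w}. c u = u}" by blast
    moreover have "{u, v} \<notin> E" if "u \<in> T" "v \<in> T" "d u \<noteq> u" "d v \<noteq> v" "d u = d v" for u v
    proof -
      have "u = w \<longleftrightarrow> v = w" using that d ct(1) sT by metis
      then show ?thesis using that c(1) d loop unfolding star_map_def
        by (cases "u = w") auto
    qed
    moreover have "d v \<in> T \<union> S \<and> (d v \<in> T \<longrightarrow> d (d v) = d v) \<and> (d v \<noteq> v \<longrightarrow> {v, d v} \<in> E)"
      if "v \<in> T" for v
      using that d ct[of v] ws sT by (cases "v = w") auto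
    ultimately show ?thesis using c(2) by (intro exI[of _ d]) auto
  next
    case False
    then have TC: "T \<in> components V E"
      by (intro component_isolated[OF G T]) auto
    show ?thesis
    proof (cases "tight E T")
      case True
      obtain v where v: "v \<in> T" using components_partition(3)[OF G TC] by blast
      obtain c where c: "star_map (T - {v}) E c" "2 * card {u\<in>T - {v}. c u = u} + 1 \<le> card T"
        using factor_critical_star_map[OF G fc v TV] by blast
      \<comment> \<open>The unmatched vertex \<open>v\<close> becomes a singleton star; this is the
        additional centre that only tight components need.\<close>
      define d where "d = c(v := v)"
      have d: "d v = v" "\<And>u. u \<noteq> v \<Longrightarrow> d u = c u" by (auto simp: d_def)
      have ct: "c u \<in> T" "c u \<noteq> v" "c (c u) = c u" "c u \<noteq> u \<Longrightarrow> {u, c u} \<in> E" if "u \<in> T" "u \<noteq> v" for u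
        using c(1) that by (auto simp: star_map_def)
      have "{u\<in>T. d u = u} = insert v {u\<in>T - {v}. c u = u}" using d v by auto
      then have "2 * card {u\<in>T. d u = u} \<le> card T + 1" using c(2) finT by simp
      moreover have "{u, w} \<notin> E" if "u \<in> T" "w \<in> T" "d u \<noteq> u" "d w \<noteq> w" "d u = d w" for u w
        using that c(1) d unfolding star_map_def by (cases "u = v"; cases "w = v") auto
      moreover have "d u \<in> T \<union> S \<and> (d u \<in> T \<longrightarrow> d (d u) = d u) \<and> (d u \<noteq> u \<longrightarrow> {u, d u} \<in> E)"
        if "u \<in> T" for u
        using that d ct[of u] by (cases "u = v") auto
      ultimately show ?thesis using True TC
        by (intro exI[of _ d]) (auto simp: tight_components_def)
    next
      case False
      then obtain c where c: "star_map T E c" "2 * card {u\<in>T. c u = u} + 1 \<le> card T"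
        using not_tight_star_map[OF G fc TV] by blast
      then show ?thesis by (intro exI[of _ c]) (auto simp: star_map_def)
    qed
  qed
qed

text \<open>The vertices of \<open>S\<close> are made centres and the maps of the components are
  glued together. The bounds of \<open>component_star_map\<close>, summed and combined with
  Gallai--Edmonds, give at most \<open>card M + \<tau>\<close> centres.\<close>

lemma star_map_exists:
  assumes G: "simple_graph V E"
  shows "\<exists>c. star_map V E c \<and> 2 * card {v\<in>V. c v = v} \<le> card V + card (tight_components V E)"
proof -
  have finV: "finite V" using G by (simp add: simple_graph_def)
  obtain S M where S: "S \<subseteq> V" and M: "matching E V M"
    and fc: "\<And>T. T \<in> components (V - S) (induced_edges E (V - S)) \<Longrightarrow> factor_critical E T"
    and card: "card V + card S \<le> 2 * card M + card (components (V - S) (induced_edges E (V - S)))"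
    using gallai_edmonds[OF G] by blast
  define \<C> where "\<C> = components (V - S) (induced_edges E (V - S))"
  have H: "simple_graph (V - S) (induced_edges E (V - S))" using simple_graph_induced[OF G] by blast
  note part = components_partition[OF H, folded \<C>_def]
  define P where "P T c \<longleftrightarrow>
      (\<forall>v\<in>T. c v \<in> T \<union> S \<and> (c v \<in> T \<longrightarrow> c (c v) = c v) \<and> (c v \<noteq> v \<longrightarrow> {v, c v} \<in> E)) \<and>
      (\<forall>u\<in>T. \<forall>v\<in>T. c u \<noteq> u \<longrightarrow> c v \<noteq> v \<longrightarrow> c u = c v \<longrightarrow> {u, v} \<notin> E) \<and>
      2 * card {v\<in>T. c v = v} + 1 \<le> card T + (if T \<in> tight_components V E then 2 else 0)" for T c
  have "\<forall>T\<in>\<C>. \<exists>c. P T c"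
    using component_star_map[OF G S] fc unfolding \<C>_def P_def by blast
  then obtain f where "\<forall>T\<in>\<C>. P T (f T)" by metis
  note f_all = this[unfolded P_def]
  have f: "f T v \<in> T \<union> S \<and> (f T v \<in> T \<longrightarrow> f T (f T v) = f T v) \<and> (f T v \<noteq> v \<longrightarrow> {v, f T v} \<in> E)"
    if "T \<in> \<C>" "v \<in> T" for T v
    using f_all that by blast
  have f_leaves: "{u, v} \<notin> E"
    if "T \<in> \<C>" "u \<in> T" "v \<in> T" "f T u \<noteq> u" "f T v \<noteq> v" "f T u = f T v" for T u v
    using f_all that by blast
  have f_card: "2 * card {v\<in>T. f T v = v} + 1 \<le> card T + (if T \<in> tight_components V E then 2 else 0)"
    if "T \<in> \<C>" for T
    using f_all that by blast
  define K where "K v = (THE T. T \<in> \<C> \<and> v \<in> T)" for v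
  have K: "K v = T" if "T \<in> \<C>" "v \<in> T" for v T
    unfolding K_def using that part(2) by (intro the_equality) (auto simp: pairwise_def disjnt_def)
  define c where "c v = (if v \<in> S then v else f (K v) v)" for v
  have cS: "c v = v" if "v \<in> S" for v using that by (simp add: c_def)
  have cT: "c v = f T v" if "T \<in> \<C>" "v \<in> T" for v T
    using that part(1) K by (auto simp: c_def)
  have inT: "\<exists>T\<in>\<C>. v \<in> T" if "v \<in> V" "v \<notin> S" for v using that part(1) by blast
  have TVS: "T \<subseteq> V - S" if "T \<in> \<C>" for T using that part(1) by blast
  have "star_map V E c"
    unfolding star_map_def
  proof (intro conjI ballI impI)
    fix v assume v: "v \<in> V"
    have "c v \<in> V \<and> c (c v) = c v \<and> (c v \<noteq> v \<longrightarrow> {v, c v} \<in> E)"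
    proof (cases "v \<in> S")
      case True
      then show ?thesis using cS v by simp
    next
      case False
      then obtain T where T: "T \<in> \<C>" "v \<in> T" using inT v by blast
      have cv: "c v = f T v" using cT[OF T] .
      consider "f T v \<in> T" | "f T v \<in> S" using f[OF T] by blast
      then show ?thesis
      proof cases
        case 1
        then show ?thesis using f[OF T] cv cT[OF T(1) 1] TVS[OF T(1)] by auto
      next
        case 2
        then show ?thesis using f[OF T] cv cS S by auto
      qed
    qed
    then show "c v \<in> V" "c (c v) = c v" "c v \<noteq> v \<Longrightarrow> {v, c v} \<in> E" by auto
  next
    fix u v assume uv: "u \<in> V" "v \<in> V" "c u \<noteq> u" "c v \<noteq> v" "c u = c v"
    then have "u \<notin> S" "v \<notin> S" using cS by auto
    then obtain T where T: "T \<in> \<C>" "u \<in> T" using inT uv by blast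
    show "{u, v} \<notin> E"
    proof (cases "v \<in> T")
      case True
      then show ?thesis using f_leaves[OF T True] cT T uv by auto
    next
      case False
      \<comment> \<open>Leaves from several components may share a centre in \<open>S\<close>; they
        are nonadjacent because no edge of \<open>V - S\<close> joins two components.\<close>
      have "{u, v} \<notin> induced_edges E (V - S)"
        using components_edge[OF H, folded \<C>_def, OF T(1)] T False by blast
      then show ?thesis using uv \<open>u \<notin> S\<close> \<open>v \<notin> S\<close> by (auto simp: induced_edges_def)
    qed
  qed
  moreover have "2 * card {v\<in>V. c v = v} \<le> card V + card (tight_components V E)"
  proof -
    have finT: "finite T" if "T \<in> \<C>" for T using TVS[OF that] finV by (auto intro: finite_subset)
    have finC: "finite \<C>" by (rule part(4))
    have "{v\<in>V. c v = v} \<subseteq> S \<union> (\<Union>T\<in>\<C>. {v\<in>T. f T v = v})"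
    proof
      fix v assume v: "v \<in> {v\<in>V. c v = v}"
      show "v \<in> S \<union> (\<Union>T\<in>\<C>. {v\<in>T. f T v = v})"
      proof (cases "v \<in> S")
        case False
        then obtain T where T: "T \<in> \<C>" "v \<in> T" using inT v by blast
        then have "f T v = v" using cT[OF T] v by simp
        then show ?thesis using T by blast
      qed simp
    qed
    then have "card {v\<in>V. c v = v} \<le> card (S \<union> (\<Union>T\<in>\<C>. {v\<in>T. f T v = v}))"
      using finT finC finV S by (intro card_mono) (auto intro: finite_subset)
    also have "\<dots> \<le> card S + (\<Sum>T\<in>\<C>. card {v\<in>T. f T v = v})"
      by (rule order.trans[OF card_Un_le add_left_mono[OF card_UN_le[OF finC]]])
    finally have 1: "card {v\<in>V. c v = v} \<le> card S + (\<Sum>T\<in>\<C>. card {v\<in>T. f T v = v})" .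
    have "2 * (\<Sum>T\<in>\<C>. card {v\<in>T. f T v = v}) + card \<C> = (\<Sum>T\<in>\<C>. 2 * card {v\<in>T. f T v = v} + 1)"
      by (simp only: sum_distrib_left sum.distrib card_eq_sum)
    also have "\<dots> \<le> (\<Sum>T\<in>\<C>. card T + (if T \<in> tight_components V E then 2 else 0))"
      by (intro sum_mono f_card)
    also have "\<dots> = (\<Sum>T\<in>\<C>. card T) + 2 * card (\<C> \<inter> tight_components V E)"
      using finC by (simp add: sum.distrib sum.If_cases)
    also have "(\<Sum>T\<in>\<C>. card T) = card (V - S)"
      using card_Union_disjoint[OF part(2) finT] part(1) by simp
    also have "card (\<C> \<inter> tight_components V E) \<le> card (tight_components V E)"
      using components_partition(4)[OF G]
      by (intro card_mono) (auto simp: tight_components_def)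
    finally have 2: "2 * (\<Sum>T\<in>\<C>. card {v\<in>T. f T v = v}) + card \<C>
      \<le> card (V - S) + 2 * card (tight_components V E)" by simp
    have 3: "card (V - S) + card S = card V"
      using S finV by (metis add.commute card_Diff_subset card_mono finite_subset le_add_diff_inverse)
    \<comment> \<open>The terms in \<open>card S\<close> and \<open>card \<C>\<close> cancel,
      leaving twice the number of centres at most \<open>2 * card M + 2 * \<tau>\<close>, and
      \<open>2 * card M + \<tau>\<close> is at most the number of vertices.\<close>
    show ?thesis using 1 2 3 card card_tight_components_le[OF G M] unfolding \<C>_def[symmetric] by linarith
  qed
  ultimately show ?thesis by blast
qed

subsection \<open>Signing the stars\<close>

text \<open>The two signs give opposite cross terms, so one of them is not positive. One sign thus
  controls all three squares at once.\<close>

lemma sign_choice: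
  fixes L B Q l b r :: real
  obtains \<chi> :: real where "\<chi> = 1 \<or> \<chi> = -1"
    "(L + \<chi> * l)\<^sup>2 + (B + \<chi> * b)\<^sup>2 + (Q + \<chi> * r)\<^sup>2 \<le> L\<^sup>2 + B\<^sup>2 + Q\<^sup>2 + l\<^sup>2 + b\<^sup>2 + r\<^sup>2"
proof (cases "L * l + B * b + Q * r \<le> 0")
  case True
  then show thesis by (intro that[of 1]) (auto simp: power2_eq_square algebra_simps)
next
  case False
  then show thesis by (intro that[of "-1"]) (auto simp: power2_eq_square algebra_simps)
qed

text \<open>Leaves with a common centre are nonadjacent, so only centre-leaf edges remain; this
  makes every edge inside a star a cut edge.\<close>

lemma star_induced_edges:
  assumes G: "simple_graph V E" and star: "star_map V E c" and f: "f \<in> V" "c f = f"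
  shows "induced_edges E {v\<in>V. c v = f} = (\<lambda>u. {f, u}) ` ({v\<in>V. c v = f} - {f})"
proof (intro equalityI subsetI)
  fix e assume "e \<in> induced_edges E {v\<in>V. c v = f}"
  then have e: "e \<in> E" "e \<subseteq> {v\<in>V. c v = f}" by (auto simp: induced_edges_def)
  then obtain a b where ab: "e = {a, b}" "a \<noteq> b" using G by (auto simp: simple_graph_def card_2_iff)
  have "a = f \<or> b = f"
    using star e ab unfolding star_map_def by auto
  then show "e \<in> (\<lambda>u. {f, u}) ` ({v\<in>V. c v = f} - {f})" using ab e by auto
next
  fix e assume "e \<in> (\<lambda>u. {f, u}) ` ({v\<in>V. c v = f} - {f})"
  then obtain u where u: "u \<in> V" "c u = f" "u \<noteq> f" "e = {f, u}" by auto
  then have "e \<in> E" using star by (auto simp: star_map_def insert_commute)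
  then show "e \<in> induced_edges E {v\<in>V. c v = f}" using u f by (auto simp: induced_edges_def)
qed

text \<open>Derandomised second moment argument: the stars are coloured one after the other, and each
  new star is flipped so that the cross term of the three squares is not positive. The term
  \<open>card {v\<in>V. c v \<in> F} - card F\<close> counts the star edges, each of which contributes \<open>-1\<close> to the sum of products.\<close>

lemma star_signing:
  fixes V :: "'a set"
  assumes G: "simple_graph V E" and star: "star_map V E c" and F: "F \<subseteq> {v\<in>V. c v = v}"
  shows "\<exists>x :: 'a \<Rightarrow> real. (\<forall>v. x v = 1 \<or> x v = -1) \<and>
    (\<Sum>v\<in>{v\<in>V. c v \<in> F}. degree E v * x v)\<^sup>2 + (\<Sum>v\<in>{v\<in>V. c v \<in> F}. x v)\<^sup>2 +
    ((\<Sum>e\<in>induced_edges E {v\<in>V. c v \<in> F}. \<Prod>v\<in>e. x v) + (real (card {v\<in>V. c v \<in> F}) - card F))\<^sup>2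
    \<le> (\<Sum>f\<in>F. 2 * (\<Sum>v\<in>{v\<in>V. c v = f}. real (degree E v))\<^sup>2 + (real (card {v\<in>V. c v = f}))\<^sup>2)"
proof -
  have finV: "finite V" using G by (simp add: simple_graph_def)
  have finE: "finite E" by (rule simple_graph_finite_edges[OF G])
  have "finite F" using F finV by (auto intro: finite_subset)
  then show ?thesis using F
  proof (induction rule: finite_induct)
    case empty
    have "induced_edges E {} = {}" using G by (auto simp: induced_edges_def simple_graph_def)
    then show ?case by (auto intro!: exI[of _ "\<lambda>_. 1"])
  next
    case (insert f F)
    define U where "U = {v\<in>V. c v \<in> F}"
    define S where "S = {v\<in>V. c v = f}"
    define D where "D = (\<Sum>v\<in>S. real (degree E v))"
    obtain x :: "'a \<Rightarrow> real" where x: "\<And>v. x v = 1 \<or> x v = -1" and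
      le: "(\<Sum>v\<in>U. degree E v * x v)\<^sup>2 + (\<Sum>v\<in>U. x v)\<^sup>2 +
        ((\<Sum>e\<in>induced_edges E U. \<Prod>v\<in>e. x v) + (real (card U) - card F))\<^sup>2
        \<le> (\<Sum>f\<in>F. 2 * (\<Sum>v\<in>{v\<in>V. c v = f}. real (degree E v))\<^sup>2 + (real (card {v\<in>V. c v = f}))\<^sup>2)"
      using insert.IH insert.prems unfolding U_def by auto
    have f: "f \<in> V" "c f = f" "f \<in> S" using insert.prems by (auto simp: S_def)
    have U': "{v\<in>V. c v \<in> insert f F} = U \<union> S" by (auto simp: U_def S_def)
    have dis: "U \<inter> S = {}" using insert.hyps by (auto simp: U_def S_def)
    have fin: "finite U" "finite S" using finV by (auto simp: U_def S_def)
    \<comment> \<open>The centre and its leaves get opposite signs. \<open>z\<close> is the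
      colouring before the flip by \<open>\<chi>\<close>, and \<open>X\<close> collects the edges
      between the new star and the earlier ones.\<close>
    define y :: "'a \<Rightarrow> real" where "y v = (if v = f then 1 else -1)" for v
    define z where "z v = (if v \<in> S then y v else x v)" for v
    define X where "X = {e\<in>E. e \<subseteq> U \<union> S \<and> \<not> e \<subseteq> U \<and> \<not> e \<subseteq> S}"
    define l where "l = (\<Sum>v\<in>S. degree E v * y v)"
    define b where "b = (\<Sum>v\<in>S. y v)"
    define r where "r = (\<Sum>e\<in>X. \<Prod>v\<in>e. z v)"
    obtain \<chi> :: real where \<chi>: "\<chi> = 1 \<or> \<chi> = -1" and
      \<chi>_le: "((\<Sum>v\<in>U. degree E v * x v) + \<chi> * l)\<^sup>2 + ((\<Sum>v\<in>U. x v) + \<chi> * b)\<^sup>2 +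
        (((\<Sum>e\<in>induced_edges E U. \<Prod>v\<in>e. x v) + (real (card U) - card F)) + \<chi> * r)\<^sup>2
        \<le> (\<Sum>v\<in>U. degree E v * x v)\<^sup>2 + (\<Sum>v\<in>U. x v)\<^sup>2 +
        ((\<Sum>e\<in>induced_edges E U. \<Prod>v\<in>e. x v) + (real (card U) - card F))\<^sup>2 + l\<^sup>2 + b\<^sup>2 + r\<^sup>2"
      using sign_choice[where L="\<Sum>v\<in>U. degree E v * x v" and l=l and B="\<Sum>v\<in>U. x v" and b=b
        and Q="(\<Sum>e\<in>induced_edges E U. \<Prod>v\<in>e. x v) + (real (card U) - card F)" and r=r] by blast
    define w where "w v = (if v \<in> S then \<chi> * y v else x v)" for v
    have wU: "w v = x v" if "v \<in> U" for v using that dis by (auto simp: w_def)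
    have wS: "w v = \<chi> * y v" if "v \<in> S" for v using that by (simp add: w_def)
    have y_abs: "\<bar>y v\<bar> = 1" for v by (simp add: y_def)
    have x_abs: "\<bar>x v\<bar> = 1" for v using x[of v] by auto
    have \<chi>2: "\<chi> * \<chi> = 1" using \<chi> by auto
    have w: "w v = 1 \<or> w v = -1" for v using x[of v] \<chi> by (auto simp: w_def y_def)
    have z_abs: "\<bar>z v\<bar> = 1" for v by (simp add: z_def y_abs x_abs)
    have L: "(\<Sum>v\<in>U \<union> S. degree E v * w v) = (\<Sum>v\<in>U. degree E v * x v) + \<chi> * l"
      using fin dis by (simp add: sum.union_disjoint wU wS l_def sum_distrib_left mult.left_commute)
    have B: "(\<Sum>v\<in>U \<union> S. w v) = (\<Sum>v\<in>U. x v) + \<chi> * b"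
      using fin dis by (simp add: sum.union_disjoint wU wS b_def sum_distrib_left)
    have edgesS: "(\<Sum>e\<in>induced_edges E S. \<Prod>v\<in>e. w v) = 1 - real (card S)"
    proof -
      have "(\<Sum>e\<in>induced_edges E S. \<Prod>v\<in>e. w v) = (\<Sum>u\<in>S - {f}. \<Prod>v\<in>{f, u}. w v)"
        unfolding star_induced_edges[OF G star f(1,2), folded S_def]
        by (subst sum.reindex) (auto simp: inj_on_def doubleton_eq_iff)
      also have "\<dots> = (\<Sum>u\<in>S - {f}. - 1)"
        using f(3) by (intro sum.cong) (auto simp: wS y_def \<chi>2)
      also have "\<dots> = 1 - real (card S)" using f(3) fin(2) card.remove[OF fin(2) f(3)] by simp
      finally show ?thesis .
    qed
    \<comment> \<open>Exactly one endpoint lies in the new star, so \<open>\<chi>\<close> factors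
      out once; inside the star it appears twice and cancels.\<close>
    have edgesX: "(\<Prod>v\<in>e. w v) = \<chi> * (\<Prod>v\<in>e. z v)" if "e \<in> X" for e
    proof -
      have "card e = 2" using G that by (simp add: X_def simple_graph_def)
      then obtain a b where ab: "e = {a, b}" "a \<noteq> b" by (meson card_2_iff)
      then have "(a \<in> S \<and> b \<notin> S) \<or> (a \<notin> S \<and> b \<in> S)" using that dis by (auto simp: X_def)
      then show ?thesis using ab by (auto simp: w_def z_def)
    qed
    have split: "induced_edges E (U \<union> S) = (induced_edges E U \<union> induced_edges E S) \<union> X"
      by (auto simp: induced_edges_def X_def)
    have ne: "e \<noteq> {}" if "e \<in> E" for e using G that by (auto simp: simple_graph_def)
    have disU: "induced_edges E U \<inter> induced_edges E S = {}"
      using dis ne unfolding induced_edges_def by blast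
    have disX: "(induced_edges E U \<union> induced_edges E S) \<inter> X = {}"
      by (auto simp: induced_edges_def X_def)
    have finI: "finite (induced_edges E A)" for A using finE by (simp add: induced_edges_def)
    have finX: "finite X" using finE by (simp add: X_def)
    have eU: "(\<Sum>e\<in>induced_edges E U. \<Prod>v\<in>e. w v) = (\<Sum>e\<in>induced_edges E U. \<Prod>v\<in>e. x v)"
      using wU by (intro sum.cong prod.cong) (auto simp: induced_edges_def)
    have eX: "(\<Sum>e\<in>X. \<Prod>v\<in>e. w v) = \<chi> * r"
      by (simp add: r_def sum_distrib_left edgesX)
    \<comment> \<open>The correction grows by \<open>card S - 1\<close>, which cancels the sum over
      the star edges in \<open>edgesS\<close>; only \<open>\<chi> * r\<close> is added to the third
      square.\<close>
    have cards: "real (card (U \<union> S)) - card (insert f F) = real (card U) + card S - card F - 1"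
      using fin dis insert.hyps by (simp add: card_Un_disjoint)
    have Q: "(\<Sum>e\<in>induced_edges E (U \<union> S). \<Prod>v\<in>e. w v) + (real (card (U \<union> S)) - card (insert f F))
      = ((\<Sum>e\<in>induced_edges E U. \<Prod>v\<in>e. x v) + (real (card U) - card F)) + \<chi> * r"
      unfolding split cards
      using finI finX disU disX by (simp add: sum.union_disjoint eU eX edgesS)
    have "\<bar>l\<bar> \<le> D"
      unfolding l_def D_def by (rule order_trans[OF sum_abs]) (simp add: abs_mult y_abs)
    then have l: "l\<^sup>2 \<le> D\<^sup>2" by (rule abs_le_square_iff[THEN iffD1, OF order_trans]) simp
    have "\<bar>b\<bar> \<le> card S"
      unfolding b_def by (rule order_trans[OF sum_abs]) (simp add: y_abs)
    then have b: "b\<^sup>2 \<le> (real (card S))\<^sup>2" by (simp add: abs_le_square_iff[symmetric])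
    \<comment> \<open>Every edge of \<open>X\<close> meets the new star, so the degree sum bounds
      \<open>r\<close> as it bounds \<open>l\<close>; this is the origin of the factor 2 on the
      squared degree sum.\<close>
    have "\<bar>r\<bar> \<le> D"
    proof -
      have "\<bar>r\<bar> \<le> card X"
        unfolding r_def by (rule order_trans[OF sum_abs]) (simp add: abs_prod z_abs)
      also have "card X \<le> card (\<Union>v\<in>S. {e\<in>E. v \<in> e})"
        using fin finE by (intro card_mono) (auto simp: X_def)
      also have "\<dots> \<le> (\<Sum>v\<in>S. degree E v)"
        using card_UN_le[OF fin(2)] by (simp add: degree_def)
      finally show ?thesis by (simp add: D_def)
    qed
    then have r: "r\<^sup>2 \<le> D\<^sup>2" by (rule abs_le_square_iff[THEN iffD1, OF order_trans]) simp
    have "(\<Sum>f\<in>insert f F. 2 * (\<Sum>v\<in>{v\<in>V. c v = f}. real (degree E v))\<^sup>2 + (real (card {v\<in>V. c v = f}))\<^sup>2)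
      = 2 * D\<^sup>2 + (real (card S))\<^sup>2 +
        (\<Sum>f\<in>F. 2 * (\<Sum>v\<in>{v\<in>V. c v = f}. real (degree E v))\<^sup>2 + (real (card {v\<in>V. c v = f}))\<^sup>2)"
      using insert.hyps by (simp add: D_def S_def)
    then show ?case unfolding U'
      using w L B Q \<chi>_le le l b r by (intro exI[of _ w]) auto
  qed
qed

section \<open>Edge counts of a signing and second moment bounds\<close>

lemma sum_edges_degree:
  fixes g :: "'a \<Rightarrow> real"
  assumes "simple_graph V E"
  shows "(\<Sum>e\<in>E. \<Sum>v\<in>e. g v) = (\<Sum>v\<in>V. degree E v * g v)"
proof -
  have fin: "finite V" "finite E"
    using assms simple_graph_finite_edges by (auto simp: simple_graph_def)
  have "(\<Sum>e\<in>E. \<Sum>v\<in>e. g v) = (\<Sum>e\<in>E. \<Sum>v\<in>{v\<in>V. v \<in> e}. g v)"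
    using assms by (intro sum.cong) (auto simp: simple_graph_def)
  also have "\<dots> = (\<Sum>v\<in>V. \<Sum>e\<in>{e\<in>E. v \<in> e}. g v)"
    by (rule sum.swap_restrict[OF fin(2,1)])
  finally show ?thesis by (simp add: degree_def)
qed

lemma sum_degree: "simple_graph V E \<Longrightarrow> (\<Sum>v\<in>V. real (degree E v)) = 2 * card E"
  using sum_edges_degree[of V E "\<lambda>_. 1"] by (simp add: simple_graph_def)

text \<open>For an edge with ends \<open>a\<close> and \<open>b\<close>, the indicator that both
  ends have sign \<open>s\<close> is \<open>(1 + s * x a) * (1 + s * x b) / 4\<close>; expand with
  \<open>s * s = 1\<close> and sum over the edges.\<close>

lemma card_induced_edges_signing:
  fixes x :: "'a \<Rightarrow> real"
  assumes G: "simple_graph V E" and x: "\<And>v. x v = 1 \<or> x v = -1" and s: "s = 1 \<or> s = -1"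
  shows "real (card (induced_edges E {v\<in>V. x v = s})) =
    (card E + s * (\<Sum>v\<in>V. degree E v * x v) + (\<Sum>e\<in>E. \<Prod>v\<in>e. x v)) / 4"
proof -
  have finE: "finite E" by (rule simple_graph_finite_edges[OF G])
  have *: "(if e \<subseteq> {v\<in>V. x v = s} then 1 else 0) = (1 + s * (\<Sum>v\<in>e. x v) + (\<Prod>v\<in>e. x v)) / 4"
    if e: "e \<in> E" for e
  proof -
    obtain a b where ab: "e = {a, b}" "a \<noteq> b"
      using G e by (auto simp: simple_graph_def card_2_iff)
    moreover have "a \<in> V" "b \<in> V" using G e ab by (auto simp: simple_graph_def)
    ultimately show ?thesis using x[of a] x[of b] s by auto
  qed
  have "real (card (induced_edges E {v\<in>V. x v = s})) = (\<Sum>e\<in>E. if e \<subseteq> {v\<in>V. x v = s} then 1 else 0)"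
    using finE by (simp add: induced_edges_def sum.If_cases Int_def)
  also have "\<dots> = (\<Sum>e\<in>E. (1 + s * (\<Sum>v\<in>e. x v) + (\<Prod>v\<in>e. x v)) / 4)"
    by (intro sum.cong refl *)
  also have "\<dots> = (card E + s * (\<Sum>e\<in>E. \<Sum>v\<in>e. x v) + (\<Sum>e\<in>E. \<Prod>v\<in>e. x v)) / 4"
    by (simp add: sum_divide_distrib[symmetric] sum.distrib sum_distrib_left)
  finally show ?thesis unfolding sum_edges_degree[OF G] .
qed

text \<open>Bounded leaf degrees limit the degree sum of every star to
  \<open>(1 + K) * \<Delta>\<close>, and a sum of squares is at most the maximum times the sum. The
  sums over all stars are \<open>2 * card E\<close> and \<open>card V\<close>.\<close>

lemma bounded_star_signing:
  fixes V :: "'a set" and K \<Delta> :: real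
  assumes G: "simple_graph V E" and star: "star_map V E c"
    and leaves: "\<And>v. v \<in> V \<Longrightarrow> c v \<noteq> v \<Longrightarrow> real (degree E v) \<le> K"
    and max: "\<And>v. v \<in> V \<Longrightarrow> real (degree E v) \<le> \<Delta>" and "K \<ge> 0" "\<Delta> \<ge> 1"
  shows "\<exists>x :: 'a \<Rightarrow> real. (\<forall>v. x v = 1 \<or> x v = -1) \<and>
    (\<Sum>v\<in>V. degree E v * x v)\<^sup>2 + (\<Sum>v\<in>V. x v)\<^sup>2 +
     ((\<Sum>e\<in>E. \<Prod>v\<in>e. x v) + (real (card V) - card {v\<in>V. c v = v}))\<^sup>2
     \<le> 4 * (1 + K) * \<Delta> * card E + 2 * \<Delta> * card V"
proof -
  have finV: "finite V" and finE: "finite E"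
    using G simple_graph_finite_edges by (auto simp: simple_graph_def)
  define F where "F = {v\<in>V. c v = v}"
  define S where "S f = {v\<in>V. c v = f}" for f
  define D where "D f = (\<Sum>v\<in>S f. real (degree E v))" for f
  have finF: "finite F" and finS: "finite (S f)" for f using finV by (auto simp: F_def S_def)
  have V: "{v\<in>V. c v \<in> F} = V" using star by (auto simp: star_map_def F_def)
  have E: "induced_edges E V = E" using G by (auto simp: induced_edges_def simple_graph_def)
  have cF: "c ` V \<subseteq> F" using star by (auto simp: star_map_def F_def)
  have bound: "D f \<le> (1 + K) * \<Delta>" "real (card (S f)) \<le> 2 * \<Delta>" if f: "f \<in> F" for f
  proof -
    have fS: "f \<in> S f" "f \<in> V" using f by (auto simp: F_def S_def)
    have "card (S f - {f}) \<le> degree E f"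
      unfolding degree_def
    proof (rule card_inj_on_le)
      show "inj_on (\<lambda>u. {u, f}) (S f - {f})" by (auto simp: inj_on_def doubleton_eq_iff)
      show "(\<lambda>u. {u, f}) ` (S f - {f}) \<subseteq> {e\<in>E. f \<in> e}"
        using star by (auto simp: S_def star_map_def)
      show "finite {e\<in>E. f \<in> e}" using finE by simp
    qed
    then have leaves_le: "real (card (S f - {f})) \<le> \<Delta>" using max[OF fS(2)] by linarith
    \<comment> \<open>The centre adds one to the leaf count, and \<open>\<Delta> + 1\<close> is at
      most \<open>2 * \<Delta>\<close>.\<close>
    then show "real (card (S f)) \<le> 2 * \<Delta>" using card.remove[OF finS fS(1)] \<open>\<Delta> \<ge> 1\<close> by simp
    have "D f = degree E f + (\<Sum>v\<in>S f - {f}. real (degree E v))"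
      unfolding D_def by (rule sum.remove[OF finS fS(1)])
    also have "(\<Sum>v\<in>S f - {f}. real (degree E v)) \<le> of_nat (card (S f - {f})) * K"
      by (intro sum_bounded_above leaves) (auto simp: S_def)
    also have "\<dots> \<le> \<Delta> * K" using leaves_le \<open>K \<ge> 0\<close> by (intro mult_right_mono) auto
    finally show "D f \<le> (1 + K) * \<Delta>" using max[OF fS(2)] by (simp add: algebra_simps)
  qed
  have "(\<Sum>f\<in>F. 2 * (D f)\<^sup>2 + (real (card (S f)))\<^sup>2)
    \<le> (\<Sum>f\<in>F. 2 * ((1 + K) * \<Delta>) * D f + 2 * \<Delta> * real (card (S f)))"
  proof (intro sum_mono add_mono)
    fix f assume f: "f \<in> F"
    have "D f \<ge> 0" by (simp add: D_def sum_nonneg)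
    then show "2 * (D f)\<^sup>2 \<le> 2 * ((1 + K) * \<Delta>) * D f"
      using mult_right_mono[OF bound(1)[OF f], of "D f"] by (simp add: power2_eq_square)
    show "(real (card (S f)))\<^sup>2 \<le> 2 * \<Delta> * real (card (S f))"
      using mult_right_mono[OF bound(2)[OF f], of "real (card (S f))"] by (simp add: power2_eq_square)
  qed
  also have "\<dots> = 2 * ((1 + K) * \<Delta>) * (\<Sum>f\<in>F. D f) + 2 * \<Delta> * (\<Sum>f\<in>F. \<Sum>v\<in>S f. 1)"
    by (simp add: sum.distrib sum_distrib_left)
  also have "(\<Sum>f\<in>F. D f) = 2 * card E"
    unfolding D_def S_def using sum.group[OF finV finF cF, of "\<lambda>v. real (degree E v)"] sum_degree[OF G] by simp
  also have "(\<Sum>f\<in>F. \<Sum>v\<in>S f. 1) = real (card V)"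
    unfolding S_def using sum.group[OF finV finF cF, of "\<lambda>_. 1 :: real"] by simp
  finally have "(\<Sum>f\<in>F. 2 * (D f)\<^sup>2 + (real (card (S f)))\<^sup>2)
    \<le> 4 * (1 + K) * \<Delta> * card E + 2 * \<Delta> * card V" by (simp add: algebra_simps)
  moreover obtain x :: "'a \<Rightarrow> real" where "\<And>v. x v = 1 \<or> x v = -1"
    "(\<Sum>v\<in>V. degree E v * x v)\<^sup>2 + (\<Sum>v\<in>V. x v)\<^sup>2 +
     ((\<Sum>e\<in>E. \<Prod>v\<in>e. x v) + (real (card V) - card F))\<^sup>2
     \<le> (\<Sum>f\<in>F. 2 * (D f)\<^sup>2 + (real (card (S f)))\<^sup>2)"
    using star_signing[OF G star, of F] unfolding D_def S_def V E by (auto simp: F_def)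
  ultimately show ?thesis unfolding F_def by (meson order.trans)
qed

text \<open>Turning a leaf into a fixed point affects no other vertex, because only centres are
  images. This splits off high-degree leaves.\<close>

lemma star_map_isolate:
  assumes "star_map V E c"
  shows "star_map V E (\<lambda>v. if P v then v else c v)"
  using assms unfolding star_map_def by auto

text \<open>Markov's inequality for the degree sequence.\<close>

lemma card_high_degree:
  fixes K :: real
  assumes G: "simple_graph V E"
  shows "K * card {v\<in>V. real (degree E v) > K} \<le> 2 * card E"
proof -
  have finV: "finite V" using G by (simp add: simple_graph_def)
  have "K * card {v\<in>V. real (degree E v) > K} \<le> (\<Sum>v\<in>{v\<in>V. real (degree E v) > K}. real (degree E v))"
    using sum_bounded_below[of "{v\<in>V. real (degree E v) > K}" K "\<lambda>v. real (degree E v)"]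
    by (simp add: mult.commute)
  also have "\<dots> \<le> (\<Sum>v\<in>V. real (degree E v))" using finV by (intro sum_mono2) auto
  finally show ?thesis using sum_degree[OF G] by simp
qed

subsection \<open>Balancing\<close>

text \<open>Moving a vertex of degree at most \<open>K\<close> adds at most \<open>K\<close> edges
  to its new side, and at most \<open>\<beta> / 2\<close> moves are needed. The larger side has at
  least half of the vertices, so by the second bound on \<open>\<beta>\<close> it has enough of low
  degree.\<close>

lemma rebalance_ordered:
  fixes K \<beta> b :: real
  assumes G: "simple_graph V E" and W: "W1 \<union> W2 = V" "W1 \<inter> W2 = {}" "card W2 \<le> card W1"
    and \<beta>: "real (card W1) - card W2 \<le> \<beta>" "\<beta> / 2 + card {v\<in>V. real (degree E v) > K} \<le> card V / 2"
    and b: "real (card (induced_edges E W1)) \<le> b" "real (card (induced_edges E W2)) \<le> b" and "K \<ge> 0"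
  shows "\<exists>V1 V2. bisection V V1 V2 \<and> (\<forall>W\<in>{V1, V2}. real (card (induced_edges E W)) \<le> b + K * \<beta> / 2)"
proof -
  have finV: "finite V" and finE: "finite E"
    using G simple_graph_finite_edges by (auto simp: simple_graph_def)
  have fin: "finite W1" "finite W2" using W finV by (auto intro: finite_subset)
  have cV: "card V = card W1 + card W2" using W fin card_Un_disjoint by blast
  \<comment> \<open>Rounding down leaves a difference of 0 or 1, as a bisection allows.\<close>
  define t where "t = (card W1 - card W2) div 2"
  have t: "real t \<le> \<beta> / 2" "2 * t \<le> card W1 - card W2" "card W1 - card W2 \<le> 2 * t + 1"
    using \<beta>(1) W(3) unfolding t_def by linarith+
  define H where "H = {v\<in>V. real (degree E v) > K}"
  have "card W1 - card H \<le> card (W1 - H)" by (rule diff_card_le_card_Diff) (use finV in \<open>simp add: H_def\<close>)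
  moreover have "real (card W1) \<ge> card V / 2" using cV W(3) by simp
  ultimately have "t \<le> card (W1 - H)" using t(1) \<beta>(2) unfolding H_def[symmetric] by linarith
  then obtain A where A: "A \<subseteq> W1 - H" "card A = t" "finite A"
    by (rule obtain_subset_with_card_n)
  have finI: "finite (induced_edges E X)" for X using finE by (simp add: induced_edges_def)
  have K\<beta>: "K * real t \<le> K * \<beta> / 2" using mult_left_mono[OF t(1) \<open>K \<ge> 0\<close>] by simp
  have "bisection V (W1 - A) (W2 \<union> A)"
  proof -
    have "card (W1 - A) = card W1 - t" using A by (simp add: card_Diff_subset subset_iff)
    moreover have "card (W2 \<union> A) = card W2 + t"
      using A fin W(2) by (subst card_Un_disjoint) auto
    moreover have "t \<le> card W1" using A fin by (metis Diff_subset card_mono subset_trans)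
    ultimately show ?thesis using W A t unfolding bisection_def by auto
  qed
  moreover have "real (card (induced_edges E (W1 - A))) \<le> b + K * \<beta> / 2"
  proof -
    have "card (induced_edges E (W1 - A)) \<le> card (induced_edges E W1)"
      using finI by (intro card_mono) (auto simp: induced_edges_def)
    moreover have "0 \<le> K * real t" using \<open>K \<ge> 0\<close> by simp
    ultimately show ?thesis using b K\<beta> by linarith
  qed
  moreover have "real (card (induced_edges E (W2 \<union> A))) \<le> b + K * \<beta> / 2"
  proof -
    have "card (induced_edges E (W2 \<union> A)) \<le> card (induced_edges E W2 \<union> (\<Union>v\<in>A. {e\<in>E. v \<in> e}))"
      using finI finE A by (intro card_mono) (auto simp: induced_edges_def)
    also have "\<dots> \<le> card (induced_edges E W2) + (\<Sum>v\<in>A. degree E v)"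
      unfolding degree_def
      by (rule order.trans[OF card_Un_le add_left_mono[OF card_UN_le[OF A(3)]]])
    finally have "real (card (induced_edges E (W2 \<union> A))) \<le>
      card (induced_edges E W2) + (\<Sum>v\<in>A. real (degree E v))" by (simp flip: of_nat_sum of_nat_add)
    also have "(\<Sum>v\<in>A. real (degree E v)) \<le> of_nat (card A) * K"
      using A(1) W(1) by (intro sum_bounded_above) (auto simp: H_def)
    finally show ?thesis using b K\<beta> A(2) by (simp add: mult.commute)
  qed
  ultimately show ?thesis by blast
qed

lemma rebalance:
  fixes K \<beta> b :: real
  assumes G: "simple_graph V E" and W: "W1 \<union> W2 = V" "W1 \<inter> W2 = {}"
    and \<beta>: "\<bar>real (card W1) - card W2\<bar> \<le> \<beta>" "\<beta> / 2 + card {v\<in>V. real (degree E v) > K} \<le> card V / 2"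
    and b: "real (card (induced_edges E W1)) \<le> b" "real (card (induced_edges E W2)) \<le> b" and "K \<ge> 0"
  shows "\<exists>V1 V2. bisection V V1 V2 \<and> (\<forall>W\<in>{V1, V2}. real (card (induced_edges E W)) \<le> b + K * \<beta> / 2)"
proof (cases "card W2 \<le> card W1")
  case True
  then show ?thesis using \<beta>(1) by (intro rebalance_ordered[OF G W True _ \<beta>(2) b \<open>K \<ge> 0\<close>]) simp
next
  case False
  then show ?thesis using \<beta>(1) W
    by (intro rebalance_ordered[OF G, of W2 W1, OF _ _ _ _ \<beta>(2) b(2,1) \<open>K \<ge> 0\<close>]) auto
qed

section \<open>Assembly and choice of constants\<close>

text \<open>The two bounds on \<open>K\<close> keep the vertices of degree above \<open>K\<close>
  few: at most \<open>n / 4\<close>, so that balancing has room, and at most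
  \<open>2 * \<epsilon> * n\<close>, so that isolating them adds few stars. The bound on
  \<open>\<gamma>\<close> makes all deviations at most \<open>\<eta> * n\<close>.\<close>

lemma judicious_bisection:
  fixes C \<epsilon> K \<eta> \<gamma> :: real
  assumes G: "simple_graph V E" and m: "real (card E) \<le> C * card V"
    and max: "\<And>v. v \<in> V \<Longrightarrow> real (degree E v) \<le> \<gamma> * card V" and n: "1 \<le> \<gamma> * card V"
    and C: "C > 0" and \<epsilon>: "\<epsilon> > 0" and K: "8 * C \<le> K" "C \<le> \<epsilon> * K"
    and \<eta>: "0 < \<eta>" "\<eta> \<le> 1 / 2" "\<eta> * (1 + K) \<le> \<epsilon>"
    and \<gamma>: "\<gamma> > 0" "\<gamma> * (4 * C * (1 + K) + 2) \<le> \<eta>\<^sup>2"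
  shows "\<exists>V1 V2. bisection V V1 V2 \<and> (\<forall>W\<in>{V1, V2}. real (card (induced_edges E W))
    \<le> real (card E) / 4 - (real (card V) - real (card (tight_components V E))) / 8 + \<epsilon> * card V)"
proof -
  define n where "n = real (card V)"
  define \<tau> where "\<tau> = real (card (tight_components V E))"
  have finV: "finite V" using G by (simp add: simple_graph_def)
  have K0: "K > 0" using C K(1) by linarith
  have n0: "n \<ge> 0" by (simp add: n_def)
  define H where "H = {v\<in>V. real (degree E v) > K}"
  have KH: "K * card H \<le> 2 * C * n"
    using card_high_degree[OF G, of K] m unfolding H_def n_def by linarith
  have H1: "real (card H) \<le> n / 4"
  proof -
    have "K * card H \<le> K * (n / 4)" using KH mult_right_mono[OF K(1) n0] by linarith
    then show ?thesis using K0 by simp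
  qed
  have H2: "real (card H) \<le> 2 * \<epsilon> * n"
  proof -
    have "K * card H \<le> K * (2 * \<epsilon> * n)" using KH mult_right_mono[OF K(2) n0] by (simp add: algebra_simps)
    then show ?thesis using K0 by simp
  qed
  obtain c where c: "star_map V E c" "2 * card {v\<in>V. c v = v} \<le> card V + card (tight_components V E)"
    using star_map_exists[OF G] by blast
  \<comment> \<open>Leaves of degree above \<open>K\<close> become singletons, at the cost of at
    most \<open>card H\<close> new centres.\<close>
  define d where "d v = (if real (degree E v) > K then v else c v)" for v
  have star: "star_map V E d" unfolding d_def by (rule star_map_isolate[OF c(1)])
  have leaves: "real (degree E v) \<le> K" if "d v \<noteq> v" for v
    using that by (auto simp: d_def split: if_splits)
  define F where "F = {v\<in>V. d v = v}"
  have "card F \<le> card ({v\<in>V. c v = v} \<union> H)"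
    using finV by (intro card_mono) (auto simp: F_def d_def H_def split: if_splits)
  also have "\<dots> \<le> card {v\<in>V. c v = v} + card H" by (rule card_Un_le)
  finally have "real (card F) \<le> real (card {v\<in>V. c v = v}) + card H" by linarith
  moreover have "2 * real (card {v\<in>V. c v = v}) \<le> n + \<tau>"
    using c(2) unfolding n_def \<tau>_def by linarith
  ultimately have F: "real (card F) \<le> (n + \<tau>) / 2 + 2 * \<epsilon> * n"
    using H2 by argo
  obtain x :: "'a \<Rightarrow> real" where x: "\<And>v. x v = 1 \<or> x v = -1" and
    x_le: "(\<Sum>v\<in>V. degree E v * x v)\<^sup>2 + (\<Sum>v\<in>V. x v)\<^sup>2 + ((\<Sum>e\<in>E. \<Prod>v\<in>e. x v) + (n - card F))\<^sup>2
     \<le> 4 * (1 + K) * (\<gamma> * n) * card E + 2 * (\<gamma> * n) * n"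
    using bounded_star_signing[OF G star leaves max less_imp_le[OF K0] n]
    unfolding n_def F_def by blast
  define L where "L = (\<Sum>v\<in>V. degree E v * x v)"
  define B where "B = (\<Sum>v\<in>V. x v)"
  define Q where "Q = (\<Sum>e\<in>E. \<Prod>v\<in>e. x v)"
  have "4 * (1 + K) * (\<gamma> * n) * card E \<le> 4 * (1 + K) * (\<gamma> * n) * (C * n)"
    using m K0 \<gamma>(1) n0 unfolding n_def by (intro mult_left_mono) auto
  then have "L\<^sup>2 + B\<^sup>2 + (Q + (n - card F))\<^sup>2 \<le> \<gamma> * (4 * C * (1 + K) + 2) * n\<^sup>2"
    using x_le unfolding L_def B_def Q_def by (simp add: algebra_simps power2_eq_square)
  also have "\<dots> \<le> \<eta>\<^sup>2 * n\<^sup>2" using \<gamma>(2) by (intro mult_right_mono) auto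
  finally have sq: "L\<^sup>2 + B\<^sup>2 + (Q + (n - card F))\<^sup>2 \<le> (\<eta> * n)\<^sup>2" by (simp add: power_mult_distrib)
  have \<eta>n: "0 \<le> \<eta> * n" using \<eta>(1) n0 by simp
  have "L\<^sup>2 \<le> (\<eta> * n)\<^sup>2" "B\<^sup>2 \<le> (\<eta> * n)\<^sup>2" "(Q + (n - card F))\<^sup>2 \<le> (\<eta> * n)\<^sup>2"
    using sq zero_le_power2[of L] zero_le_power2[of B] zero_le_power2[of "Q + (n - card F)"] by linarith+
  then have LBQ: "\<bar>L\<bar> \<le> \<eta> * n" "\<bar>B\<bar> \<le> \<eta> * n" "\<bar>Q + (n - card F)\<bar> \<le> \<eta> * n"
    using \<eta>n by (auto dest!: abs_le_square_iff[THEN iffD2])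
  define W where "W s = {v\<in>V. x v = s}" for s
  \<comment> \<open>Each side has \<open>(card E + s * L + Q) / 4\<close> edges, where
    \<open>L\<close> contributes at most \<open>\<eta> * n\<close> and \<open>Q\<close> at most
    \<open>\<eta> * n - (n - card F)\<close>.\<close>
  define b where "b = (card E + 2 * (\<eta> * n) - (n - card F)) / 4"
  have W_le: "real (card (induced_edges E (W s))) \<le> b" if s: "s = 1 \<or> s = -1" for s
  proof -
    have "real (card (induced_edges E (W s))) = (card E + s * L + Q) / 4"
      unfolding W_def L_def Q_def by (rule card_induced_edges_signing[OF G x s])
    then show ?thesis using s LBQ(1,3) unfolding b_def by (auto simp: abs_le_iff)
  qed
  have V: "W 1 \<union> W (-1) = V" "W 1 \<inter> W (-1) = {}" using x by (auto simp: W_def)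
  have "B = (\<Sum>v\<in>W 1. x v) + (\<Sum>v\<in>W (-1). x v)"
    unfolding B_def using V finV by (subst sum.union_disjoint[symmetric]) (auto simp: W_def)
  also have "\<dots> = real (card (W 1)) - card (W (-1))" by (simp add: W_def)
  finally have "\<bar>real (card (W 1)) - card (W (-1))\<bar> \<le> \<eta> * n" using LBQ(2) by simp
  moreover have "\<eta> * n / 2 + card H \<le> card V / 2"
    using H1 mult_right_mono[OF \<eta>(2) n0] unfolding n_def by linarith
  ultimately obtain V1 V2 where bis: "bisection V V1 V2"
    "\<forall>W\<in>{V1, V2}. real (card (induced_edges E W)) \<le> b + K * (\<eta> * n) / 2"
    using rebalance[OF G V, of "\<eta> * n" K b] W_le K0 unfolding H_def by auto
  have "\<eta> * n * (1 + K) \<le> \<epsilon> * n" using mult_right_mono[OF \<eta>(3) n0] by (simp add: algebra_simps)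
  \<comment> \<open>The singletons split off account for \<open>\<epsilon> * n / 2\<close>; the
    deviations and the rebalancing together cost \<open>\<eta> * n * (1 + K) / 2\<close>, the other
    half.\<close>
  then have "b + K * (\<eta> * n) / 2 \<le> card E / 4 - (n - \<tau>) / 8 + \<epsilon> * n"
    using F unfolding b_def by (simp add: field_simps)
  then show ?thesis using bis unfolding n_def \<tau>_def by (meson order.trans)
qed

theorem theorem1p11:
  fixes C \<epsilon> :: real
  assumes "C > 0" and "\<epsilon> > 0"
  shows "\<exists>(\<gamma>::real) (n0::nat). \<gamma> > 0 \<and> n0 > 0 \<and>
    (\<forall>(V::'a set) (E::'a set set) (n::nat) (m::nat) (\<tau>::nat).
       simple_graph V E \<and> card V = n \<and> n \<ge> n0 \<and> card E = m \<and> real m \<le> C * real n \<and>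
       (\<forall>v\<in>V. real (degree E v) \<le> \<gamma> * real n) \<and> card (tight_components V E) = \<tau> \<longrightarrow>
       (\<exists>V1 V2. bisection V V1 V2 \<and>
          (\<forall>W\<in>{V1, V2}. real (card (induced_edges E W))
              \<le> real m / 4 - (real n - real \<tau>) / 8 + \<epsilon> * real n)))"
proof -
  \<comment> \<open>The summands serve the two lower bounds on \<open>K\<close>; then
    \<open>\<eta>\<close> is chosen small in terms of \<open>K\<close>, and \<open>\<gamma>\<close>
    in terms of both.\<close>
  define K where "K = 8 * C + C / \<epsilon>"
  have K: "8 * C \<le> K" "C \<le> \<epsilon> * K" "K > 0"
    using assms by (auto simp: K_def distrib_left intro: add_pos_pos)
  define \<eta> where "\<eta> = min (1 / 2) (\<epsilon> / (1 + K))"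
  have \<eta>: "0 < \<eta>" "\<eta> \<le> 1 / 2" unfolding \<eta>_def using K assms by (simp, intro min.cobounded1)
  have "\<eta> \<le> \<epsilon> / (1 + K)" by (simp add: \<eta>_def)
  then have \<eta>': "\<eta> * (1 + K) \<le> \<epsilon>" using K by (simp add: pos_le_divide_eq)
  define \<gamma> where "\<gamma> = \<eta>\<^sup>2 / (4 * C * (1 + K) + 2)"
  have pos: "4 * C * (1 + K) + 2 > 0" using K assms by (simp add: add_pos_pos)
  then have \<gamma>: "\<gamma> > 0" "\<gamma> * (4 * C * (1 + K) + 2) \<le> \<eta>\<^sup>2" using \<eta> by (auto simp: \<gamma>_def)
  \<comment> \<open>Large \<open>n\<close> ensures that the degree bound \<open>\<gamma> * n\<close>
    is at least 1, which is needed to bound the star sizes.\<close>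
  define n0 where "n0 = Suc (nat \<lceil>1 / \<gamma>\<rceil>)"
  have large: "1 \<le> \<gamma> * real n" if "n \<ge> n0" for n
  proof -
    have "1 / \<gamma> \<le> real n" using that unfolding n0_def by linarith
    then show ?thesis using \<gamma>(1) by (simp add: field_simps)
  qed
  show ?thesis
  proof (intro exI[of _ \<gamma>] exI[of _ n0] conjI allI impI)
    show "\<gamma> > 0" "n0 > 0" using \<gamma>(1) by (auto simp: n0_def)
  next
    fix V :: "'a set" and E n m \<tau>
    assume *: "simple_graph V E \<and> card V = n \<and> n \<ge> n0 \<and> card E = m \<and> real m \<le> C * real n \<and>
      (\<forall>v\<in>V. real (degree E v) \<le> \<gamma> * real n) \<and> card (tight_components V E) = \<tau>"
    then show "\<exists>V1 V2. bisection V V1 V2 \<and> (\<forall>W\<in>{V1, V2}. real (card (induced_edges E W))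
      \<le> real m / 4 - (real n - real \<tau>) / 8 + \<epsilon> * real n)"
      using judicious_bisection[OF _ _ _ large assms K(1,2) \<eta> \<eta>' \<gamma>, of V E] by blast
  qed
qed

end
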